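(* Let $d\ge 1$ and $\gamma\in(-\infty,1)$. There is a constant $C=C(d,\gamma)$, depending only on $d$ and $\gamma$, such that for all $\lambda\in(0,1/100)$, all $\delta\in(0,1]$ and all $f\in L^2(\mathbb{R}^d)$, $$\|f\|_{L^2}^2\le C\left[\frac{1}{|\log(\delta\lambda)|^{1-\gamma}}\int_{B_{\frac{1}{5\delta}}}\int_{\mathbb{R}^d}\frac{|f(x+h)-f(x)|^2}{|h|^d\,|\log(\delta|h|)|^\gamma}\,dx\,dh+|\log(\lambda)|\,\frac{\|f\|_{L^2}^2}{\log\left(2+\frac{\|f\|_{L^2}}{\|f\|_{\dot H^{-1}}}\right)}\right].$$
   Context: $B_r$ is the ball of radius $r$ in $\mathbb{R}^d$ centered at the origin. $\|f\|_{\dot H^{-1}}=\big(\int_{\mathbb{R}^d}|\xi|^{-2}|\hat f(\xi)|^2\,d\xi\big)^{1/2}\in[0,+\infty]$, where $\hat f$ is the Fourier transform normalized to be an isometry of $L^2$. If $\|f\|_{\dot H^{-1}}=+\infty$ the ratio $\|f\|_{L^2}/\|f\|_{\dot H^{-1}}$ is interpreted as $0$; for $f=0$ both sides are $0$. *)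

theory Defs
  imports "HOL-Analysis.Analysis"
begin

definition ennsqrt :: "ennreal \<Rightarrow> ennreal" where
  "ennsqrt a = (if a = \<infinity> then \<infinity> else ennreal (sqrt (enn2real a)))"

lemma ennsqrt_power2: "(ennsqrt a)\<^sup>2 = a"
  by (cases a) (auto simp: ennsqrt_def ennreal_power infinity_ennreal_def)

definition L2_norm :: "('a::euclidean_space \<Rightarrow> complex) \<Rightarrow> ennreal" where
  "L2_norm f = ennsqrt (\<integral>\<^sup>+x. ennreal ((cmod (f x))\<^sup>2) \<partial>lebesgue)"

(* Functions, not classes modulo null sets; everything below is insensitive to
   changing a function on a null set. *)
definition L2 :: "('a::euclidean_space \<Rightarrow> complex) set" where
  "L2 = {f \<in> borel_measurable lebesgue. L2_norm f < \<infinity>}"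

definition fourier_integral :: "('a::euclidean_space \<Rightarrow> complex) \<Rightarrow> 'a \<Rightarrow> complex" where
  "fourier_integral f \<xi> =
     of_real ((2 * pi) powr (- real DIM('a) / 2)) * (LINT x|lebesgue. cis (- (x \<bullet> \<xi>)) * f x)"

(* The unitary Fourier transform on L2: the limit in L2 of the Fourier integrals of the
   truncations of f to balls of radius n (each truncation is in L1). By Plancherel's theorem
   the limit exists; it is unique up to a null set, and the choice operator picks a
   representative. *)
definition fourier_L2 :: "('a::euclidean_space \<Rightarrow> complex) \<Rightarrow> 'a \<Rightarrow> complex" where
  "fourier_L2 f = (SOME g. g \<in> L2 \<and>
     (\<lambda>n::nat. L2_norm (\<lambda>\<xi>. fourier_integral (\<lambda>x. indicator (ball 0 (real n)) x * f x) \<xi> - g \<xi>))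
       \<longlonglongrightarrow> 0)"

definition Hdot_minus1_norm :: "('a::euclidean_space \<Rightarrow> complex) \<Rightarrow> ennreal" where
  "Hdot_minus1_norm f =
     ennsqrt (\<integral>\<^sup>+\<xi>. ennreal ((cmod (fourier_L2 f \<xi>))\<^sup>2 / (norm \<xi>)\<^sup>2) \<partial>lebesgue)"

end

theory Submission
  imports Defs "HOL-Probability.Characteristic_Functions"
begin

text \<open>
  Write \<open>D h\<close> for the squared \<open>L\<^sup>2\<close> norm of \<open>f (x + h) - f x\<close>, and damp the Fourier transform by
  the Gaussian \<open>exp (- (\<epsilon> \<bar>\<xi>\<bar>)\<^sup>2 / 2)\<close>. Fubini shows that what the damping removes from the energy of
  \<open>f\<close> is half the average of \<open>D\<close> against the heat kernel of width \<open>\<epsilon>\<close>, whereas what it leaves is at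
  most a multiple of the squared homogeneous \<open>H\<^sup>-\<^sup>1\<close> norm divided by \<open>\<epsilon>\<^sup>2\<close>. Hence, up to constants,
  the energy of \<open>f\<close> is bounded by the heat kernel average of \<open>D\<close> at every scale \<open>\<epsilon>\<close> that exceeds
  the ratio of the \<open>H\<^sup>-\<^sup>1\<close> norm to the \<open>L\<^sup>2\<close> norm.

  If this ratio is not much smaller than \<open>\<lambda>\<close>, the logarithmic term alone suffices. Otherwise all
  scales \<open>\<epsilon> = exp (- s) / \<delta>\<close> with \<open>s\<close> between \<open>L / 2 + B\<close> and \<open>L + B\<close> are admissible, where
  \<open>L = \<bar>ln (\<delta> \<lambda>)\<bar>\<close>. Adding up about \<open>L / 2\<close> of them, one for each unit step of \<open>s\<close>, the heat
  kernels sum to at most a multiple of \<open>L powr \<gamma>\<close> times the singular kernel of the theorem.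
\<close>

section \<open>Gaussians\<close>

definition gauss_weight :: "real \<Rightarrow> 'a::euclidean_space \<Rightarrow> real" where
  "gauss_weight \<epsilon> \<xi> = exp (- (\<epsilon> * norm \<xi>)\<^sup>2 / 2)"

text \<open>The density of the centred normal distribution whose covariance is the square of
  \<epsilon> times the identity, that is, the heat kernel at time
  \<open>\<epsilon>\<^sup>2 / 2\<close>. Thus \<epsilon> is a length, and
  \<open>gauss_weight \<epsilon>\<close> is the characteristic function of this density.\<close>

definition heat_kernel :: "real \<Rightarrow> 'a::euclidean_space \<Rightarrow> real" where
  "heat_kernel \<epsilon> z = (1 / (sqrt (2 * pi) * \<epsilon>)) ^ DIM('a) * exp (- (norm z / \<epsilon>)\<^sup>2 / 2)"

lemma gauss_weight_measurable [measurable]: "gauss_weight \<epsilon> \<in> borel_measurable borel"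
  unfolding gauss_weight_def by measurable

lemma heat_kernel_measurable [measurable]: "heat_kernel \<epsilon> \<in> borel_measurable borel"
  unfolding heat_kernel_def by measurable

lemma gauss_weight_nonneg [simp]: "0 \<le> gauss_weight \<epsilon> \<xi>"
  by (simp add: gauss_weight_def)

lemma heat_kernel_nonneg [simp]: "0 < \<epsilon> \<Longrightarrow> 0 \<le> heat_kernel \<epsilon> z"
  by (simp add: heat_kernel_def)

text \<open>This rescales the known characteristic function of the standard normal
  distribution.\<close>

lemma fourier_gaussian_real:
  fixes z :: real
  assumes "0 < \<epsilon>"
  shows "has_bochner_integral lborel (\<lambda>x. cis (- (z * x)) * exp (- (\<epsilon> * x)\<^sup>2 / 2))
           (complex_of_real (sqrt (2 * pi) / \<epsilon> * exp (- (z / \<epsilon>)\<^sup>2 / 2)))"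
proof -
  \<comment> \<open>The case of width 1. Multiplying by \<open>sqrt (2 * pi)\<close> cancels the
    normalisation of the normal density.\<close>
  have std: "has_bochner_integral lborel (\<lambda>x. iexp (t * x) * exp (- x\<^sup>2 / 2))
      (complex_of_real (sqrt (2 * pi) * exp (- t\<^sup>2 / 2)))" (is "has_bochner_integral _ ?h _") for t :: real
  proof -
    interpret real_distribution std_normal_distribution by (rule real_dist_normal_dist)
    have "integrable std_normal_distribution (\<lambda>x. iexp (t * x))"
      by (rule integrable_iexp) auto
    then have int: "integrable lborel (\<lambda>x. std_normal_density x *\<^sub>R iexp (t * x))"
      by (subst (asm) integrable_density) auto
    have "(LINT x|lborel. std_normal_density x *\<^sub>R iexp (t * x)) = complex_of_real (exp (- t\<^sup>2 / 2))"
      using fun_cong[OF char_std_normal_distribution, of t]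
      by (simp add: char_def integral_density)
    with int have "has_bochner_integral lborel (\<lambda>x. std_normal_density x *\<^sub>R iexp (t * x))
        (complex_of_real (exp (- t\<^sup>2 / 2)))"
      by (simp add: has_bochner_integral_iff)
    then have "has_bochner_integral lborel
        (\<lambda>x. of_real (sqrt (2 * pi)) * (std_normal_density x *\<^sub>R iexp (t * x)))
        (of_real (sqrt (2 * pi)) * complex_of_real (exp (- t\<^sup>2 / 2)))"
      by (intro has_bochner_integral_mult_right) auto
    moreover have "complex_of_real (sqrt (2 * pi)) * (std_normal_density x *\<^sub>R iexp (t * x)) = ?h x" for x
    proof -
      have "complex_of_real (sqrt (2 * pi)) * complex_of_real (1 / sqrt (2 * pi)) = 1"
        by (simp flip: of_real_mult)
      then show ?thesis by (simp add: std_normal_density_def scaleR_conv_of_real mult_ac)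
    qed
    ultimately show ?thesis by simp
  qed
  \<comment> \<open>Substitution of \<open>\<epsilon> * x\<close> for the variable, at frequency
    \<open>- z / \<epsilon>\<close>.\<close>
  have "has_bochner_integral lborel (\<lambda>x. iexp (- z / \<epsilon> * (0 + \<epsilon> * x)) * exp (- (0 + \<epsilon> * x)\<^sup>2 / 2))
     (complex_of_real (sqrt (2 * pi) * exp (- (- z / \<epsilon>)\<^sup>2 / 2)) /\<^sub>R \<bar>\<epsilon>\<bar>)"
    using lborel_has_bochner_integral_real_affine_iff
     [of \<epsilon> "\<lambda>x. iexp (- z / \<epsilon> * x) * exp (- x\<^sup>2 / 2)" _ 0] std[of "- z / \<epsilon>"] assms by simp
  then show ?thesis
    using assms by (simp add: cis_conv_exp scaleR_conv_of_real field_simps)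
qed

text \<open>Both the character and the Gaussian factor over the coordinates, so the integral is a
  product of one-dimensional ones.\<close>

lemma fourier_gaussian:
  fixes z :: "'a::euclidean_space"
  assumes "0 < \<epsilon>"
  shows "has_bochner_integral lborel (\<lambda>\<xi>. cis (- (z \<bullet> \<xi>)) * gauss_weight \<epsilon> \<xi>)
           (complex_of_real ((2 * pi) ^ DIM('a) * heat_kernel \<epsilon> z))"
proof -
  interpret product_sigma_finite "\<lambda>_::'a. lborel :: real measure" ..
  let ?k = "\<lambda>b x. cis (- ((z \<bullet> b) * x)) * complex_of_real (exp (- (\<epsilon> * x)\<^sup>2 / 2))"
  let ?c = "\<lambda>b. complex_of_real (sqrt (2 * pi) / \<epsilon> * exp (- ((z \<bullet> b) / \<epsilon>)\<^sup>2 / 2))"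
  have k: "integrable lborel (?k b)" "integral\<^sup>L lborel (?k b) = ?c b" for b
    using fourier_gaussian_real[OF assms, of "z \<bullet> b"] by (auto simp: has_bochner_integral_iff)
  have norm_sq: "(norm x)\<^sup>2 = (\<Sum>b\<in>Basis. (x \<bullet> b)\<^sup>2)" for x :: 'a
    by (subst norm_eq_sqrt_inner, subst euclidean_inner)
       (simp add: power2_eq_square inner_sum_left sum_nonneg)
  have split: "cis (- (z \<bullet> \<xi>)) * gauss_weight \<epsilon> \<xi> = (\<Prod>b\<in>Basis. ?k b (\<xi> \<bullet> b))" for \<xi>
  proof -
    have "(\<Prod>b\<in>Basis. ?k b (\<xi> \<bullet> b)) =
        cis (\<Sum>b\<in>Basis. - ((z \<bullet> b) * (\<xi> \<bullet> b))) * exp (\<Sum>b\<in>Basis. - (\<epsilon> * (\<xi> \<bullet> b))\<^sup>2 / 2)"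
      by (simp add: prod.distrib cis_conv_exp exp_sum sum_distrib_left flip: of_real_prod)
    also have "(\<Sum>b\<in>Basis. - ((z \<bullet> b) * (\<xi> \<bullet> b))) = - (z \<bullet> \<xi>)"
      by (subst euclidean_inner[of z \<xi>]) (simp add: sum_negf)
    also have "(\<Sum>b\<in>Basis. - (\<epsilon> * (\<xi> \<bullet> b))\<^sup>2 / 2) = - (\<epsilon> * norm \<xi>)\<^sup>2 / 2"
      by (simp add: power_mult_distrib norm_sq sum_distrib_left sum_divide_distrib sum_negf)
    finally show ?thesis by (simp add: gauss_weight_def)
  qed
  have prod: "(\<Prod>b\<in>Basis. ?c b) = complex_of_real ((2 * pi) ^ DIM('a) * heat_kernel \<epsilon> z)"
  proof -
    have "(\<Prod>b\<in>Basis. ?c b) = complex_of_real (\<Prod>b\<in>Basis. sqrt (2 * pi) / \<epsilon> * exp (- ((z \<bullet> b) / \<epsilon>)\<^sup>2 / 2))"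
      by (simp only: of_real_prod)
    also have "(\<Prod>b\<in>Basis. sqrt (2 * pi) / \<epsilon> * exp (- ((z \<bullet> b) / \<epsilon>)\<^sup>2 / 2)) =
       (sqrt (2 * pi) / \<epsilon>) ^ DIM('a) * exp (\<Sum>b\<in>Basis. - ((z \<bullet> b) / \<epsilon>)\<^sup>2 / 2)"
      by (subst prod.distrib) (simp add: exp_sum)
    also have "(\<Sum>b\<in>Basis. - ((z \<bullet> b) / \<epsilon>)\<^sup>2 / 2) = - (norm z / \<epsilon>)\<^sup>2 / 2"
      by (simp add: power_divide norm_sq sum_divide_distrib sum_negf)
    also have "(sqrt (2 * pi) / \<epsilon>) ^ DIM('a) * exp (- (norm z / \<epsilon>)\<^sup>2 / 2) =
        (2 * pi) ^ DIM('a) * heat_kernel \<epsilon> z"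
    proof -
      \<comment> \<open>Each coordinate contributes one factor \<open>2 * pi\<close> beyond the
        normalisation of \<open>heat_kernel\<close>.\<close>
      have "sqrt (2 * pi) / \<epsilon> = (2 * pi) * (1 / (sqrt (2 * pi) * \<epsilon>))"
        using assms real_sqrt_pow2[of "2 * pi"] by (simp add: field_simps power2_eq_square)
      then show ?thesis
        unfolding heat_kernel_def by (simp only: power_mult_distrib mult.assoc)
    qed
    finally show ?thesis .
  qed
  have "integrable (\<Pi>\<^sub>M b\<in>Basis. lborel) (\<lambda>x. \<Prod>b\<in>Basis. ?k b (x b))"
    by (rule product_integrable_prod) (use k in auto)
  moreover have "(\<integral>x. (\<Prod>b\<in>Basis. ?k b (x b)) \<partial>(\<Pi>\<^sub>M b\<in>Basis. lborel)) = (\<Prod>b\<in>Basis. ?c b)"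
    by (subst product_integral_prod) (use k in auto)
  ultimately have "has_bochner_integral (\<Pi>\<^sub>M b\<in>Basis. lborel)
      (\<lambda>x. \<Prod>b\<in>Basis. ?k b ((\<Sum>b\<in>Basis. x b *\<^sub>R b) \<bullet> b)) (\<Prod>b\<in>Basis. ?c b)"
    by (simp add: has_bochner_integral_iff)
  \<comment> \<open>Lebesgue measure is the image of the product measure under the map from
    coordinates to vectors.\<close>
  then have "has_bochner_integral (distr (\<Pi>\<^sub>M b\<in>Basis. lborel) borel (\<lambda>f. \<Sum>b\<in>Basis. f b *\<^sub>R b))
      (\<lambda>\<xi>. \<Prod>b\<in>Basis. ?k b (\<xi> \<bullet> b)) (\<Prod>b\<in>Basis. ?c b)"
    by (intro has_bochner_integral_distr) (auto simp: cis_conv_exp)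
  then show ?thesis
    by (simp only: split prod lborel_eq[symmetric])
qed

lemma integrable_gauss_weight:
  "0 < \<epsilon> \<Longrightarrow> integrable lborel (gauss_weight \<epsilon> :: 'a::euclidean_space \<Rightarrow> real)"
  using fourier_gaussian[of \<epsilon> "0::'a"]
  by (simp add: has_bochner_integral_iff complex_of_real_integrable_eq)

text \<open>The kernel is a constant multiple of the Gaussian weight with parameter
  \<open>1 / \<epsilon>\<close>, whose integral is its transform at frequency 0.\<close>

lemma nn_integral_heat_kernel:
  assumes "0 < \<epsilon>"
  shows "(\<integral>\<^sup>+z. heat_kernel \<epsilon> z \<partial>(lborel :: 'a::euclidean_space measure)) = 1"
proof -
  let ?w = "gauss_weight (1 / \<epsilon>) :: 'a \<Rightarrow> real"
  have "(LINT \<xi>|lborel. complex_of_real (?w \<xi>)) =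
      complex_of_real ((2 * pi) ^ DIM('a) * heat_kernel (1 / \<epsilon>) (0::'a))"
    using fourier_gaussian[of "1 / \<epsilon>" "0::'a"] assms by (simp add: has_bochner_integral_iff)
  then have "(LINT \<xi>|lborel. ?w \<xi>) = (2 * pi) ^ DIM('a) * heat_kernel (1 / \<epsilon>) (0::'a)"
    by (simp only: integral_complex_of_real of_real_eq_iff)
  also have "\<dots> = (sqrt (2 * pi) * \<epsilon>) ^ DIM('a)"
  proof -
    have "2 * pi * (1 / (sqrt (2 * pi) * (1 / \<epsilon>))) = sqrt (2 * pi) * \<epsilon>"
      using assms real_sqrt_pow2[of "2 * pi"] by (simp add: field_simps power2_eq_square)
    moreover have "heat_kernel (1 / \<epsilon>) (0::'a) = (1 / (sqrt (2 * pi) * (1 / \<epsilon>))) ^ DIM('a)"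
      by (simp add: heat_kernel_def)
    ultimately show ?thesis
      by (simp only: power_mult_distrib[symmetric])
  qed
  finally have w: "(\<integral>\<^sup>+\<xi>. ?w \<xi> \<partial>lborel) = ennreal ((sqrt (2 * pi) * \<epsilon>) ^ DIM('a))"
    using integrable_gauss_weight[of "1 / \<epsilon>"] assms
    by (subst nn_integral_eq_integral) auto
  have "(\<integral>\<^sup>+z. heat_kernel \<epsilon> z \<partial>(lborel :: 'a measure)) =
      (\<integral>\<^sup>+z. ennreal ((1 / (sqrt (2 * pi) * \<epsilon>)) ^ DIM('a)) * ?w z \<partial>lborel)"
    using assms by (intro nn_integral_cong) (simp add: heat_kernel_def gauss_weight_def ennreal_mult')
  also have "\<dots> = ennreal ((1 / (sqrt (2 * pi) * \<epsilon>)) ^ DIM('a)) * ennreal ((sqrt (2 * pi) * \<epsilon>) ^ DIM('a))"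
    by (simp add: nn_integral_cmult w)
  also have "\<dots> = ennreal ((1 / (sqrt (2 * pi) * \<epsilon>) * (sqrt (2 * pi) * \<epsilon>)) ^ DIM('a))"
    unfolding power_mult_distrib[of "1 / (sqrt (2 * pi) * \<epsilon>)" "sqrt (2 * pi) * \<epsilon>"]
    using assms by (intro ennreal_mult[symmetric]) auto
  also have "\<dots> = 1"
    using assms by simp
  finally show ?thesis .
qed

section \<open>Plancherel identity with Gaussian damping\<close>

text \<open>The integral runs over \<open>lborel\<close>, not \<open>lebesgue\<close>, so that
  Tonelli and Fubini apply to Borel functions on the product space. A general function is replaced
  by a Borel representative at the very end.\<close>

definition translation_diff :: "('a::euclidean_space \<Rightarrow> complex) \<Rightarrow> 'a \<Rightarrow> ennreal" where
  "translation_diff f h = (\<integral>\<^sup>+x. ennreal ((cmod (f (x + h) - f x))\<^sup>2) \<partial>lborel)"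

definition heat_energy :: "real \<Rightarrow> ('a::euclidean_space \<Rightarrow> complex) \<Rightarrow> ennreal" where
  "heat_energy \<epsilon> f = (\<integral>\<^sup>+h. ennreal (heat_kernel \<epsilon> h) * translation_diff f h \<partial>lborel)"

lemma translation_diff_measurable [measurable]:
  assumes [measurable]: "f \<in> borel_measurable borel"
  shows "translation_diff f \<in> borel_measurable borel"
  unfolding translation_diff_def by measurable

lemma heat_kernel_minus_commute: "heat_kernel \<epsilon> (x - y) = heat_kernel \<epsilon> (y - x)"
  by (simp add: heat_kernel_def norm_minus_commute)

lemma nn_integral_lborel_translate:
  fixes f :: "'a::euclidean_space \<Rightarrow> ennreal"
  assumes [measurable]: "f \<in> borel_measurable borel"
  shows "(\<integral>\<^sup>+x. f (x + h) \<partial>lborel) = (\<integral>\<^sup>+x. f x \<partial>lborel)"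
  by (subst lborel_distr_plus[symmetric, of h]) (simp add: nn_integral_distr add.commute)

text \<open>Tonelli followed by the substitution \<open>x = y + h\<close>. In the resulting form x
  and y play symmetric roles, which prepares the expansion of the square.\<close>

lemma heat_energy_eq:
  fixes f :: "'a::euclidean_space \<Rightarrow> complex"
  assumes [measurable]: "f \<in> borel_measurable borel" and "0 < \<epsilon>"
  shows "heat_energy \<epsilon> f =
    (\<integral>\<^sup>+y. \<integral>\<^sup>+x. ennreal ((cmod (f x - f y))\<^sup>2 * heat_kernel \<epsilon> (x - y)) \<partial>lborel \<partial>lborel)"
proof -
  have "heat_energy \<epsilon> f = (\<integral>\<^sup>+h. \<integral>\<^sup>+y. ennreal ((cmod (f (y + h) - f y))\<^sup>2 * heat_kernel \<epsilon> h) \<partial>lborel \<partial>lborel)"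
    unfolding heat_energy_def translation_diff_def
  proof (rule nn_integral_cong)
    fix h :: 'a
    have "ennreal (heat_kernel \<epsilon> h) * (\<integral>\<^sup>+x. ennreal ((cmod (f (x + h) - f x))\<^sup>2) \<partial>lborel) =
        (\<integral>\<^sup>+x. ennreal (heat_kernel \<epsilon> h) * ennreal ((cmod (f (x + h) - f x))\<^sup>2) \<partial>lborel)"
      by (rule nn_integral_cmult[symmetric]) measurable
    also have "\<dots> = (\<integral>\<^sup>+x. ennreal ((cmod (f (x + h) - f x))\<^sup>2 * heat_kernel \<epsilon> h) \<partial>lborel)"
      by (subst ennreal_mult) (simp_all add: \<open>0 < \<epsilon>\<close> mult.commute)
    finally show "ennreal (heat_kernel \<epsilon> h) * (\<integral>\<^sup>+x. ennreal ((cmod (f (x + h) - f x))\<^sup>2) \<partial>lborel) =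
        (\<integral>\<^sup>+x. ennreal ((cmod (f (x + h) - f x))\<^sup>2 * heat_kernel \<epsilon> h) \<partial>lborel)" .
  qed
  also have "\<dots> = (\<integral>\<^sup>+y. \<integral>\<^sup>+h. ennreal ((cmod (f (y + h) - f y))\<^sup>2 * heat_kernel \<epsilon> h) \<partial>lborel \<partial>lborel)"
    by (rule lborel_pair.Fubini') measurable
  also have "\<dots> = (\<integral>\<^sup>+y. \<integral>\<^sup>+x. ennreal ((cmod (f x - f y))\<^sup>2 * heat_kernel \<epsilon> (x - y)) \<partial>lborel \<partial>lborel)"
  proof (rule nn_integral_cong)
    fix y :: 'a
    show "(\<integral>\<^sup>+h. ennreal ((cmod (f (y + h) - f y))\<^sup>2 * heat_kernel \<epsilon> h) \<partial>lborel) =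
        (\<integral>\<^sup>+x. ennreal ((cmod (f x - f y))\<^sup>2 * heat_kernel \<epsilon> (x - y)) \<partial>lborel)"
      using nn_integral_lborel_translate
        [of "\<lambda>x. ennreal ((cmod (f x - f y))\<^sup>2 * heat_kernel \<epsilon> (x - y))" y]
      by (simp add: add.commute)
  qed
  finally show ?thesis .
qed

text \<open>The kernel has unit mass; the second identity reduces to the first by evenness of the
  kernel and Tonelli. They evaluate the two pure terms of the expanded square.\<close>

lemma nn_integral_heat_conv:
  fixes f :: "'a::euclidean_space \<Rightarrow> real"
  assumes [measurable]: "f \<in> borel_measurable borel" and "0 < \<epsilon>" "\<And>x. 0 \<le> f x"
  shows "(\<integral>\<^sup>+y. \<integral>\<^sup>+x. ennreal (f y * heat_kernel \<epsilon> (x - y)) \<partial>lborel \<partial>lborel) = (\<integral>\<^sup>+y. f y \<partial>lborel)"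
    and "(\<integral>\<^sup>+y. \<integral>\<^sup>+x. ennreal (f x * heat_kernel \<epsilon> (x - y)) \<partial>lborel \<partial>lborel) = (\<integral>\<^sup>+y. f y \<partial>lborel)"
proof -
  have inner: "(\<integral>\<^sup>+x. ennreal (f y * heat_kernel \<epsilon> (x - y)) \<partial>lborel) = ennreal (f y)" for y
    using nn_integral_lborel_translate[of "\<lambda>x. ennreal (heat_kernel \<epsilon> x)" "- y"] assms
    by (simp add: ennreal_mult nn_integral_cmult nn_integral_heat_kernel)
  then show first: "(\<integral>\<^sup>+y. \<integral>\<^sup>+x. ennreal (f y * heat_kernel \<epsilon> (x - y)) \<partial>lborel \<partial>lborel) = (\<integral>\<^sup>+y. f y \<partial>lborel)"
    by simp
  have "(\<integral>\<^sup>+y. \<integral>\<^sup>+x. ennreal (f x * heat_kernel \<epsilon> (x - y)) \<partial>lborel \<partial>lborel) =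
        (\<integral>\<^sup>+x. \<integral>\<^sup>+y. ennreal (f x * heat_kernel \<epsilon> (y - x)) \<partial>lborel \<partial>lborel)"
  proof -
    have "(\<integral>\<^sup>+y. \<integral>\<^sup>+x. ennreal (f x * heat_kernel \<epsilon> (x - y)) \<partial>lborel \<partial>lborel) =
        (\<integral>\<^sup>+y. \<integral>\<^sup>+x. ennreal (f x * heat_kernel \<epsilon> (y - x)) \<partial>lborel \<partial>lborel)"
      by (subst heat_kernel_minus_commute) (rule refl)
    also have "\<dots> = (\<integral>\<^sup>+x. \<integral>\<^sup>+y. ennreal (f x * heat_kernel \<epsilon> (y - x)) \<partial>lborel \<partial>lborel)"
      by (rule lborel_pair.Fubini') measurable
    finally show ?thesis .
  qed
  with first show "(\<integral>\<^sup>+y. \<integral>\<^sup>+x. ennreal (f x * heat_kernel \<epsilon> (x - y)) \<partial>lborel \<partial>lborel) = (\<integral>\<^sup>+y. f y \<partial>lborel)"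
    by simp
qed

section \<open>Fourier integrals of integrable functions\<close>

lemma integrable_fourier_kernel:
  assumes "integrable lborel u"
  shows "integrable lborel (\<lambda>x. cis (- (x \<bullet> \<xi>)) * u x)"
proof (rule Bochner_Integration.integrable_bound[OF assms])
  show "(\<lambda>x. cis (- (x \<bullet> \<xi>)) * u x) \<in> borel_measurable lborel"
    using borel_measurable_integrable[OF assms] by (simp add: cis_conv_exp)
qed (simp add: norm_mult)

lemma fourier_integral_lborel:
  fixes u :: "'a::euclidean_space \<Rightarrow> complex"
  assumes [measurable]: "u \<in> borel_measurable borel"
  shows "fourier_integral u \<xi> =
    of_real ((2 * pi) powr (- real DIM('a) / 2)) * (LINT x|lborel. cis (- (x \<bullet> \<xi>)) * u x)"
  unfolding fourier_integral_def by (subst integral_completion) (simp_all add: cis_conv_exp)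

lemma fourier_integral_measurable [measurable]:
  fixes u :: "'a::euclidean_space \<Rightarrow> complex"
  assumes [measurable]: "u \<in> borel_measurable borel"
  shows "fourier_integral u \<in> borel_measurable borel"
proof -
  have "(\<lambda>\<xi>. of_real ((2 * pi) powr (- real DIM('a) / 2)) *
      (LINT x|lborel. exp (\<i> * of_real (- (x \<bullet> \<xi>))) * u x)) \<in> borel_measurable borel"
    by measurable
  then show ?thesis
    by (subst measurable_cong[OF fourier_integral_lborel]) (simp_all only: assms cis_conv_exp)
qed

lemma integrable_tensor:
  fixes f :: "'a::euclidean_space \<Rightarrow> 'c::{real_normed_field,banach,second_countable_topology}"
    and g :: "'b::euclidean_space \<Rightarrow> 'c"
  assumes f: "integrable lborel f" and g: "integrable lborel g"
  shows "integrable (lborel \<Otimes>\<^sub>M lborel) (\<lambda>(x, y). f x * g y)"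
proof (rule lborel_pair.Fubini_integrable)
  have [measurable]: "f \<in> borel_measurable borel" "g \<in> borel_measurable borel"
    using assms[THEN borel_measurable_integrable] by auto
  show "(\<lambda>(x, y). f x * g y) \<in> borel_measurable (lborel \<Otimes>\<^sub>M lborel)"
    by (subst split_beta') measurable
  show "integrable lborel (\<lambda>x. LINT y|lborel. norm (case (x, y) of (x, y) \<Rightarrow> f x * g y))"
    unfolding prod.case norm_mult integral_mult_right_zero
    by (intro integrable_mult_left integrable_norm f)
  show "AE x in lborel. integrable lborel (\<lambda>y. case (x, y) of (x, y) \<Rightarrow> f x * g y)"
    unfolding prod.case by (intro AE_I2 integrable_mult_right g)
qed

text \<open>Writing the squared modulus as a double integral of \<open>u x * cnj (u y)\<close> and
  integrating over the frequency first turns the weight into the heat kernel. The damping makes the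
  integrand jointly integrable in all variables, so that Fubini applies.\<close>

lemma gaussian_plancherel_complex:
  fixes u :: "'a::euclidean_space \<Rightarrow> complex"
  assumes [measurable]: "u \<in> borel_measurable borel" and int: "integrable lborel u" and "0 < \<epsilon>"
  shows "has_bochner_integral lborel
    (\<lambda>\<xi>. complex_of_real ((cmod (fourier_integral u \<xi>))\<^sup>2 * gauss_weight \<epsilon> \<xi>))
    (LINT p|lborel. u (fst p) * cnj (u (snd p)) * heat_kernel \<epsilon> (fst p - snd p))"
proof -
  \<comment> \<open>The integrand in the frequency and the pair p = (x, y). Its modulus is that of a
    tensor product of the weight with \<open>u (fst p) * cnj (u (snd p))\<close>.\<close>
  define K where "K \<xi> p = complex_of_real (gauss_weight \<epsilon> \<xi>) *
      ((cis (- (fst p \<bullet> \<xi>)) * u (fst p)) * (cis (snd p \<bullet> \<xi>) * cnj (u (snd p))))" for \<xi> :: 'a and p :: "'a \<times> 'a"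
  have [measurable]: "cnj \<in> borel_measurable borel"
    by (intro borel_measurable_continuous_onI continuous_intros)
  have "case_prod K \<in> borel_measurable (borel \<Otimes>\<^sub>M (borel \<Otimes>\<^sub>M borel))"
    unfolding K_def cis_conv_exp by measurable
  then have K_meas: "case_prod K \<in> borel_measurable (lborel \<Otimes>\<^sub>M lborel)"
    by (simp add: lborel_prod borel_prod)
  have uu: "integrable lborel (\<lambda>p. u (fst p) * cnj (u (snd p)))"
    using integrable_tensor[OF int integrable_cnj[OF int]]
    by (simp only: lborel_prod case_prod_unfold)
  have gw: "integrable lborel (\<lambda>\<xi>::'a. complex_of_real (gauss_weight \<epsilon> \<xi>))"
    using integrable_gauss_weight[OF \<open>0 < \<epsilon>\<close>] by (simp add: complex_of_real_integrable_eq)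
  have K: "integrable (lborel \<Otimes>\<^sub>M lborel) (case_prod K)"
  proof (rule Bochner_Integration.integrable_bound)
    show "integrable (lborel \<Otimes>\<^sub>M lborel) (\<lambda>(\<xi>::'a, p). complex_of_real (gauss_weight \<epsilon> \<xi>) * (u (fst p) * cnj (u (snd p))))"
      by (rule integrable_tensor[OF gw uu])
  qed (use K_meas in \<open>auto simp: K_def norm_mult\<close>)
  define c where "c = (2 * pi) powr (- real DIM('a) / 2)"
  have four: "fourier_integral u \<xi> = complex_of_real c * (LINT x|lborel. cis (- (x \<bullet> \<xi>)) * u x)" for \<xi>
    unfolding c_def by (rule fourier_integral_lborel) measurable
  have const: "c\<^sup>2 = 1 / (2 * pi) ^ DIM('a)"
    unfolding c_def by (simp add: power2_eq_square powr_add[symmetric] powr_minus powr_realpow inverse_eq_divide)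
  have inner_p: "(LINT p|lborel. K \<xi> p) =
      complex_of_real ((2 * pi) ^ DIM('a) * ((cmod (fourier_integral u \<xi>))\<^sup>2 * gauss_weight \<epsilon> \<xi>))" for \<xi>
  proof -
    let ?I = "LINT x|lborel. cis (- (x \<bullet> \<xi>)) * u x"
    note i1 = integrable_fourier_kernel[OF int, of \<xi>]
    have i2: "integrable lborel (\<lambda>x. cis (x \<bullet> \<xi>) * cnj (u x))"
      using integrable_cnj[OF i1] by (simp add: cis_cnj)
    have "(LINT p|lborel. K \<xi> p) = gauss_weight \<epsilon> \<xi> *
        (LINT p|(lborel \<Otimes>\<^sub>M lborel). (case p of (x, y) \<Rightarrow> (cis (- (x \<bullet> \<xi>)) * u x) * (cis (y \<bullet> \<xi>) * cnj (u y))))"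
      by (simp add: K_def lborel_prod case_prod_unfold)
    also have "\<dots> = gauss_weight \<epsilon> \<xi> * (?I * (LINT y|lborel. cis (y \<bullet> \<xi>) * cnj (u y)))"
      using lborel_pair.integral_fst[OF integrable_tensor[OF i1 i2]] by simp
    also have "(LINT y|lborel. cis (y \<bullet> \<xi>) * cnj (u y)) = cnj ?I"
      using Bochner_Integration.integral_cnj[of lborel "\<lambda>x. cis (- (x \<bullet> \<xi>)) * u x"] by (simp add: cis_cnj)
    also have "?I * cnj ?I = complex_of_real ((cmod ?I)\<^sup>2)"
      by (simp only: complex_norm_square)
    also have "(cmod ?I)\<^sup>2 = (2 * pi) ^ DIM('a) * (cmod (fourier_integral u \<xi>))\<^sup>2"
      unfolding four by (simp add: norm_mult power_mult_distrib const)
    finally show ?thesis by (simp add: mult_ac)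
  qed
  have inner_\<xi>: "(LINT \<xi>|lborel. K \<xi> p) =
      complex_of_real ((2 * pi) ^ DIM('a)) * (u (fst p) * cnj (u (snd p)) * heat_kernel \<epsilon> (fst p - snd p))" for p
  proof -
    have "(LINT \<xi>|lborel. K \<xi> p) = (LINT \<xi>|lborel. (u (fst p) * cnj (u (snd p))) *
        (cis (- ((fst p - snd p) \<bullet> \<xi>)) * gauss_weight \<epsilon> \<xi>))"
    proof (intro Bochner_Integration.integral_cong refl)
      fix \<xi>
      have "cis (- ((fst p - snd p) \<bullet> \<xi>)) = cis (- (fst p \<bullet> \<xi>)) * cis (snd p \<bullet> \<xi>)"
        by (simp add: cis_mult inner_diff_left)
      then show "K \<xi> p = (u (fst p) * cnj (u (snd p))) * (cis (- ((fst p - snd p) \<bullet> \<xi>)) * gauss_weight \<epsilon> \<xi>)"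
        by (simp only: K_def mult_ac)
    qed
    also have "\<dots> = (u (fst p) * cnj (u (snd p))) * complex_of_real ((2 * pi) ^ DIM('a) * heat_kernel \<epsilon> (fst p - snd p))"
      using fourier_gaussian[OF \<open>0 < \<epsilon>\<close>, of "fst p - snd p"] by (simp add: has_bochner_integral_iff)
    finally show ?thesis by (simp add: mult_ac)
  qed
  \<comment> \<open>Both orders of integration carry this same factor, which is divided out at the
    end.\<close>
  let ?c = "complex_of_real ((2 * pi) ^ DIM('a))"
  have "integrable lborel (\<lambda>\<xi>. LINT p|lborel. K \<xi> p)"
    by (rule lborel_pair.integrable_fst[OF K])
  moreover have "(LINT \<xi>|lborel. LINT p|lborel. K \<xi> p) = (LINT p|lborel. LINT \<xi>|lborel. K \<xi> p)"
    by (rule lborel_pair.Fubini_integral[OF K, symmetric])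
  ultimately have "has_bochner_integral lborel
     (\<lambda>\<xi>. ?c * complex_of_real ((cmod (fourier_integral u \<xi>))\<^sup>2 * gauss_weight \<epsilon> \<xi>))
     (?c * (LINT p|lborel. u (fst p) * cnj (u (snd p)) * heat_kernel \<epsilon> (fst p - snd p)))"
    unfolding inner_p inner_\<xi> by (simp add: has_bochner_integral_iff)
  from has_bochner_integral_mult_right[where c = "1 / ?c", OF this] show ?thesis
    by simp
qed

definition L2_sq :: "('a::euclidean_space \<Rightarrow> complex) \<Rightarrow> ennreal" where
  "L2_sq f = (\<integral>\<^sup>+x. ennreal ((cmod (f x))\<^sup>2) \<partial>lborel)"

text \<open>Polarisation: \<open>2 * Re (a * cnj b)\<close> is the sum of the two squared moduli
  minus the squared modulus of the difference. Integrated against the kernel, the pure terms give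
  twice \<open>L2_sq u\<close> and the difference gives the heat energy.\<close>

lemma gaussian_plancherel:
  fixes u :: "'a::euclidean_space \<Rightarrow> complex"
  assumes [measurable]: "u \<in> borel_measurable borel"
    and int: "integrable lborel u" and fin: "L2_sq u < \<infinity>" and "0 < \<epsilon>"
  shows "2 * (\<integral>\<^sup>+\<xi>. ennreal ((cmod (fourier_integral u \<xi>))\<^sup>2 * gauss_weight \<epsilon> \<xi>) \<partial>lborel)
    + heat_energy \<epsilon> u = 2 * L2_sq u"
proof -
  define k where "k p = heat_kernel \<epsilon> (fst p - snd p)" for p :: "'a \<times> 'a"
  \<comment> \<open>\<open>A\<close>, \<open>B\<close> and \<open>E\<close> are the three squares of
    the polarisation identity and \<open>T\<close> is the mixed term, all weighted by the
    kernel.\<close>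
  define A where "A p = (cmod (u (fst p)))\<^sup>2 * k p" for p
  define B where "B p = (cmod (u (snd p)))\<^sup>2 * k p" for p
  define E where "E p = (cmod (u (fst p) - u (snd p)))\<^sup>2 * k p" for p
  define T where "T p = u (fst p) * cnj (u (snd p)) * k p" for p
  have [measurable]: "cnj \<in> borel_measurable borel"
    by (intro borel_measurable_continuous_onI continuous_intros)
  have k_nonneg: "0 \<le> k p" for p
    using \<open>0 < \<epsilon>\<close> by (simp add: k_def)
  have [measurable]: "k \<in> borel_measurable (borel \<Otimes>\<^sub>M borel)"
    unfolding k_def by measurable
  have "A \<in> borel_measurable (borel \<Otimes>\<^sub>M borel)" "B \<in> borel_measurable (borel \<Otimes>\<^sub>M borel)"
      "E \<in> borel_measurable (borel \<Otimes>\<^sub>M borel)" "T \<in> borel_measurable (borel \<Otimes>\<^sub>M borel)"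
    unfolding A_def B_def E_def T_def by measurable
  then have meas [measurable]: "A \<in> borel_measurable borel" "B \<in> borel_measurable borel"
      "E \<in> borel_measurable borel" "T \<in> borel_measurable borel"
    by (simp_all add: borel_prod)
  have nonneg: "0 \<le> A p" "0 \<le> B p" "0 \<le> E p" for p
    using k_nonneg by (auto simp: A_def B_def E_def)
  have pair: "(\<integral>\<^sup>+p. ennreal (h p) \<partial>lborel) = (\<integral>\<^sup>+y. \<integral>\<^sup>+x. ennreal (h (x, y)) \<partial>lborel \<partial>lborel)"
    if [measurable]: "h \<in> borel_measurable borel" for h :: "'a \<times> 'a \<Rightarrow> real"
  proof -
    have "(\<lambda>p. ennreal (h p)) \<in> borel_measurable (lborel \<Otimes>\<^sub>M lborel)"
      unfolding lborel_prod by measurable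
    from lborel_pair.nn_integral_snd[OF this] show ?thesis
      by (simp only: lborel_prod)
  qed
  have nA: "(\<integral>\<^sup>+p. ennreal (A p) \<partial>lborel) = L2_sq u"
    unfolding L2_sq_def pair[OF meas(1)] unfolding A_def k_def fst_conv snd_conv
    by (rule nn_integral_heat_conv(2)) (use \<open>0 < \<epsilon>\<close> in auto)
  have nB: "(\<integral>\<^sup>+p. ennreal (B p) \<partial>lborel) = L2_sq u"
    unfolding L2_sq_def pair[OF meas(2)] unfolding B_def k_def fst_conv snd_conv
    by (rule nn_integral_heat_conv(1)) (use \<open>0 < \<epsilon>\<close> in auto)
  have nE: "(\<integral>\<^sup>+p. ennreal (E p) \<partial>lborel) = heat_energy \<epsilon> u"
    unfolding heat_energy_eq[OF assms(1) \<open>0 < \<epsilon>\<close>] pair[OF meas(3)]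
    unfolding E_def k_def fst_conv snd_conv ..
  \<comment> \<open>Finite energy allows passing from extended nonnegative integrals to real ones,
    which can be subtracted.\<close>
  have iA: "integrable lborel A" and iB: "integrable lborel B"
    using nonneg nA nB fin by (auto intro!: integrableI_nonneg)
  have id: "2 * Re (T p) = A p + B p - E p" for p
  proof -
    have "2 * Re (a * cnj b) = (cmod a)\<^sup>2 + (cmod b)\<^sup>2 - (cmod (a - b))\<^sup>2" for a b :: complex
      unfolding cmod_power2 by (simp add: power2_eq_square algebra_simps)
    then have "2 * Re (u (fst p) * cnj (u (snd p))) * k p =
        ((cmod (u (fst p)))\<^sup>2 + (cmod (u (snd p)))\<^sup>2 - (cmod (u (fst p) - u (snd p)))\<^sup>2) * k p"
      by (simp only:)
    then show ?thesis
      unfolding T_def A_def B_def E_def by (simp add: distrib_right left_diff_distrib)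
  qed
  have T_le: "cmod (T p) \<le> A p + B p" for p
  proof -
    have "cmod (u (fst p)) * cmod (u (snd p)) \<le> (cmod (u (fst p)))\<^sup>2 + (cmod (u (snd p)))\<^sup>2"
      using sum_squares_bound[of "cmod (u (fst p))" "cmod (u (snd p))"]
        mult_nonneg_nonneg[OF norm_ge_zero norm_ge_zero, of "u (fst p)" "u (snd p)"]
      unfolding mult.assoc by linarith
    then show ?thesis
      unfolding T_def A_def B_def distrib_right[symmetric] using k_nonneg[of p]
      by (simp add: norm_mult mult_right_mono)
  qed
  have iT: "integrable lborel T"
    by (rule Bochner_Integration.integrable_bound[of _ "\<lambda>p. A p + B p"])
       (use iA iB T_le nonneg in auto)
  have iRT: "integrable lborel (\<lambda>p. Re (T p))"
    using iT by simp
  have E_eq: "E = (\<lambda>p. A p + B p - 2 * Re (T p))"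
    using id by (auto simp: fun_eq_iff)
  have iE: "integrable lborel E"
    unfolding E_eq using iA iB iRT by auto
  have intE: "integral\<^sup>L lborel E = integral\<^sup>L lborel A + integral\<^sup>L lborel B - 2 * Re (integral\<^sup>L lborel T)"
    unfolding E_eq using iA iB iRT iT by simp
  have F: "has_bochner_integral lborel
      (\<lambda>\<xi>. complex_of_real ((cmod (fourier_integral u \<xi>))\<^sup>2 * gauss_weight \<epsilon> \<xi>)) (integral\<^sup>L lborel T)"
    using gaussian_plancherel_complex[OF assms(1) int \<open>0 < \<epsilon>\<close>] unfolding T_def k_def .
  let ?F = "\<lambda>\<xi>. (cmod (fourier_integral u \<xi>))\<^sup>2 * gauss_weight \<epsilon> \<xi>"
  have iF: "integrable lborel ?F"
    using F by (simp only: has_bochner_integral_iff complex_of_real_integrable_eq)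
  have "complex_of_real (integral\<^sup>L lborel ?F) = integral\<^sup>L lborel T"
    using F by (simp only: has_bochner_integral_iff integral_complex_of_real)
  then have intF: "integral\<^sup>L lborel ?F = Re (integral\<^sup>L lborel T)"
    by (metis Re_complex_of_real)
  have F_nn: "(\<integral>\<^sup>+\<xi>. ennreal (?F \<xi>) \<partial>lborel) = ennreal (integral\<^sup>L lborel ?F)"
    by (rule nn_integral_eq_integral[OF iF]) simp
  have E_nn: "heat_energy \<epsilon> u = ennreal (integral\<^sup>L lborel E)"
    unfolding nE[symmetric] by (rule nn_integral_eq_integral[OF iE]) (simp add: nonneg)
  have A_nn: "L2_sq u = ennreal (integral\<^sup>L lborel A)"
    unfolding nA[symmetric] by (rule nn_integral_eq_integral[OF iA]) (simp add: nonneg)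
  have B_nn: "L2_sq u = ennreal (integral\<^sup>L lborel B)"
    unfolding nB[symmetric] by (rule nn_integral_eq_integral[OF iB]) (simp add: nonneg)
  have ge0: "0 \<le> integral\<^sup>L lborel A" "0 \<le> integral\<^sup>L lborel B" "0 \<le> integral\<^sup>L lborel E" "0 \<le> integral\<^sup>L lborel ?F"
    using nonneg by (auto intro!: Bochner_Integration.integral_nonneg)
  have AB: "integral\<^sup>L lborel A = integral\<^sup>L lborel B"
    using A_nn B_nn ge0 by simp
  have "2 * ennreal (integral\<^sup>L lborel ?F) + ennreal (integral\<^sup>L lborel E) = ennreal (2 * integral\<^sup>L lborel ?F + integral\<^sup>L lborel E)"
    using ge0 by (simp add: ennreal_mult)
  also have "2 * integral\<^sup>L lborel ?F + integral\<^sup>L lborel E = 2 * integral\<^sup>L lborel A"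
    using intE intF AB by simp
  also have "ennreal (2 * integral\<^sup>L lborel A) = 2 * L2_sq u"
    using A_nn ge0 by (simp add: ennreal_mult)
  finally show ?thesis
    unfolding F_nn E_nn .
qed

text \<open>Dropping the heat energy bounds every damped integral, and Fatou's lemma removes the
  damping. The inequality suffices to carry Cauchy sequences over to the Fourier side.\<close>

lemma bessel:
  fixes u :: "'a::euclidean_space \<Rightarrow> complex"
  assumes [measurable]: "u \<in> borel_measurable borel"
    and int: "integrable lborel u" and fin: "L2_sq u < \<infinity>"
  shows "L2_sq (fourier_integral u) \<le> L2_sq u"
proof -
  define F where "F k \<xi> = ennreal ((cmod (fourier_integral u \<xi>))\<^sup>2 * gauss_weight (1 / real (Suc k)) \<xi>)" for k \<xi>
  have [measurable]: "F k \<in> borel_measurable lborel" for k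
    unfolding F_def by measurable
  have bound: "(\<integral>\<^sup>+\<xi>. F k \<xi> \<partial>lborel) \<le> L2_sq u" for k
  proof -
    have "2 * (\<integral>\<^sup>+\<xi>. F k \<xi> \<partial>lborel) \<le> 2 * L2_sq u"
      unfolding gaussian_plancherel[OF assms, of "1 / real (Suc k)", symmetric, simplified] F_def
      by simp
    then show ?thesis
      by (simp add: ennreal_mult_le_mult_iff)
  qed
  have lim: "(\<lambda>k. F k \<xi>) \<longlonglongrightarrow> ennreal ((cmod (fourier_integral u \<xi>))\<^sup>2)" for \<xi>
  proof -
    have "(\<lambda>k. (cmod (fourier_integral u \<xi>))\<^sup>2 * exp (- (1 / real (Suc k) * norm \<xi>)\<^sup>2 / 2))
      \<longlonglongrightarrow> (cmod (fourier_integral u \<xi>))\<^sup>2 * exp (- (0 * norm \<xi>)\<^sup>2 / 2)"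
      using LIMSEQ_inverse_real_of_nat by (intro tendsto_intros) (simp_all add: inverse_eq_divide)
    then show ?thesis
      unfolding F_def gauss_weight_def by (intro tendsto_ennrealI) simp
  qed
  have "L2_sq (fourier_integral u) = (\<integral>\<^sup>+\<xi>. liminf (\<lambda>k. F k \<xi>) \<partial>lborel)"
    unfolding L2_sq_def by (simp add: lim_imp_Liminf[OF _ lim])
  also have "\<dots> \<le> liminf (\<lambda>k. \<integral>\<^sup>+\<xi>. F k \<xi> \<partial>lborel)"
    by (rule nn_integral_liminf) measurable
  also have "\<dots> \<le> L2_sq u"
    by (rule Liminf_le) (auto intro!: always_eventually bound)
  finally show ?thesis .
qed

section \<open>Completeness and the Fourier transform of square integrable functions\<close>

lemma L2_norm_power2: "(L2_norm f)\<^sup>2 = L2_sq f"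
  by (simp add: L2_norm_def L2_sq_def ennsqrt_power2 nn_integral_completion)

lemma L2_norm_less_top_iff: "L2_norm f < \<infinity> \<longleftrightarrow> L2_sq f < \<infinity>"
  unfolding L2_norm_power2[symmetric] power2_eq_square
  by (auto simp: ennreal_mult_less_top)

lemma L2_norm_tendsto_0_iff: "(\<lambda>n::nat. L2_norm (f n)) \<longlonglongrightarrow> 0 \<longleftrightarrow> (\<lambda>n. L2_sq (f n)) \<longlonglongrightarrow> 0"
proof
  assume "(\<lambda>n. L2_norm (f n)) \<longlonglongrightarrow> 0"
  then have "(\<lambda>n. L2_norm (f n) * L2_norm (f n)) \<longlonglongrightarrow> 0 * 0"
    by (intro tendsto_mult_ennreal) auto
  then show "(\<lambda>n. L2_sq (f n)) \<longlonglongrightarrow> 0"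
    by (simp add: L2_norm_power2[symmetric] power2_eq_square)
next
  assume L: "(\<lambda>n. L2_sq (f n)) \<longlonglongrightarrow> 0"
  show "(\<lambda>n. L2_norm (f n)) \<longlonglongrightarrow> 0"
  proof (rule order_tendstoI)
    fix e :: ennreal assume "0 < e"
    then have "0 < e\<^sup>2"
      by (simp add: power2_eq_square ennreal_zero_less_mult_iff)
    then have "\<forall>\<^sub>F n in sequentially. L2_sq (f n) < e\<^sup>2"
      by (rule order_tendstoD(2)[OF L])
    then show "\<forall>\<^sub>F n in sequentially. L2_norm (f n) < e"
    proof eventually_elim
      case (elim n)
      show ?case
      proof (rule ccontr)
        assume "\<not> L2_norm (f n) < e"
        then have "e\<^sup>2 \<le> (L2_norm (f n))\<^sup>2"
          unfolding power2_eq_square by (intro mult_mono) auto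
        with elim show False
          by (simp add: L2_norm_power2)
      qed
    qed
  qed auto
qed

lemma cmod_add_power2_le: "(cmod (a + b))\<^sup>2 \<le> 2 * (cmod a)\<^sup>2 + 2 * (cmod b)\<^sup>2"
proof -
  have "(cmod (a + b))\<^sup>2 \<le> (cmod a + cmod b)\<^sup>2"
    by (intro power_mono norm_triangle_ineq) auto
  also have "\<dots> \<le> 2 * (cmod a)\<^sup>2 + 2 * (cmod b)\<^sup>2"
    using sum_squares_bound[of "cmod a" "cmod b"] by (simp add: power2_sum)
  finally show ?thesis .
qed

lemma ennreal_cmod_add_power2_le:
  "ennreal ((cmod (a + b))\<^sup>2) \<le> 2 * ennreal ((cmod a)\<^sup>2) + 2 * ennreal ((cmod b)\<^sup>2)"
proof -
  have "ennreal ((cmod (a + b))\<^sup>2) \<le> ennreal (2 * (cmod a)\<^sup>2 + 2 * (cmod b)\<^sup>2)"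
    by (rule ennreal_leI[OF cmod_add_power2_le])
  also have "\<dots> = 2 * ennreal ((cmod a)\<^sup>2) + 2 * ennreal ((cmod b)\<^sup>2)"
    by (simp add: ennreal_mult)
  finally show ?thesis .
qed

text \<open>A substitute for the triangle inequality: it costs a factor 2 but avoids square roots in
  \<open>ennreal\<close>.\<close>

lemma L2_sq_add_le:
  assumes [measurable]: "f \<in> borel_measurable borel" "g \<in> borel_measurable borel"
  shows "L2_sq (\<lambda>x. f x + g x) \<le> 2 * L2_sq f + 2 * L2_sq g"
proof -
  have "L2_sq (\<lambda>x. f x + g x) \<le> (\<integral>\<^sup>+x. 2 * ennreal ((cmod (f x))\<^sup>2) + 2 * ennreal ((cmod (g x))\<^sup>2) \<partial>lborel)"
    unfolding L2_sq_def by (intro nn_integral_mono ennreal_cmod_add_power2_le)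
  also have "\<dots> = 2 * L2_sq f + 2 * L2_sq g"
    unfolding L2_sq_def by (subst nn_integral_add) (auto simp: nn_integral_cmult)
  finally show ?thesis .
qed

text \<open>A rapidly Cauchy subsequence converges almost everywhere, and Fatou's lemma upgrades
  this to mean square convergence of the whole sequence.\<close>

lemma riesz_fischer:
  fixes F :: "nat \<Rightarrow> 'a::euclidean_space \<Rightarrow> complex"
  assumes meas [measurable]: "\<And>n. F n \<in> borel_measurable borel"
    and fin: "\<And>n. L2_sq (F n) < \<infinity>"
    and cauchy: "\<And>e::real. 0 < e \<Longrightarrow> \<exists>M. \<forall>m\<ge>M. \<forall>n\<ge>M. L2_sq (\<lambda>x. F m x - F n x) \<le> ennreal e"
  shows "\<exists>g \<in> borel_measurable borel. L2_sq g < \<infinity> \<and> (\<lambda>n. L2_sq (\<lambda>x. F n x - g x)) \<longlonglongrightarrow> 0"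
proof -
  \<comment> \<open>The rate \<open>(1/8)^k\<close> still leaves the summable \<open>(1/2)^k\<close>
    after multiplication by the weight \<open>4^k\<close> used below.\<close>
  have "\<exists>M. \<forall>m\<ge>M. \<forall>n\<ge>M. L2_sq (\<lambda>x. F m x - F n x) \<le> ennreal ((1/8)^k)" for k :: nat
    by (rule cauchy) simp
  then obtain M where M: "\<And>k m n. M k \<le> m \<Longrightarrow> M k \<le> n \<Longrightarrow> L2_sq (\<lambda>x. F m x - F n x) \<le> ennreal ((1/8)^k)"
    by metis
  \<comment> \<open>Adding up the thresholds makes \<open>r\<close> monotone as well as at least
    \<open>M k\<close>.\<close>
  define r where "r k = k + (\<Sum>i\<le>k. M i)" for k
  have r_ge: "M k \<le> r k" "k \<le> r k" "r k \<le> r (Suc k)" for k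
    unfolding r_def by (auto intro: order_trans[OF member_le_sum[of k "{..k}" M]])
  define D where "D k x = cmod (F (r (Suc k)) x - F (r k) x)" for k x
  have [measurable]: "D k \<in> borel_measurable borel" for k
    unfolding D_def by measurable
  have "(\<integral>\<^sup>+x. ennreal (4^k * (D k x)\<^sup>2) \<partial>lborel) \<le> ennreal ((1/2)^k)" for k
  proof -
    have "(\<integral>\<^sup>+x. ennreal (4^k * (D k x)\<^sup>2) \<partial>lborel) = ennreal (4^k) * L2_sq (\<lambda>x. F (r (Suc k)) x - F (r k) x)"
      unfolding L2_sq_def D_def by (subst nn_integral_cmult[symmetric]) (simp_all add: ennreal_mult)
    also have "\<dots> \<le> ennreal (4^k) * ennreal ((1/8)^k)"
      using r_ge by (intro mult_left_mono M) (auto intro: order_trans)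
    also have "\<dots> = ennreal ((1/2)^k)"
      by (simp add: ennreal_mult[symmetric] power_mult_distrib[symmetric])
    finally show ?thesis .
  qed
  then have "(\<Sum>k. \<integral>\<^sup>+x. ennreal (4^k * (D k x)\<^sup>2) \<partial>lborel) \<le> (\<Sum>k. ennreal ((1/2)^k))"
    by (intro suminf_le) auto
  also have "\<dots> = ennreal (\<Sum>k. (1/2)^k)"
    by (intro suminf_ennreal2) auto
  finally have "(\<integral>\<^sup>+x. (\<Sum>k. ennreal (4^k * (D k x)\<^sup>2)) \<partial>lborel) < \<infinity>"
    by (subst nn_integral_suminf) (auto simp: le_less_trans)
  then have "AE x in lborel. (\<Sum>k. ennreal (4^k * (D k x)\<^sup>2)) \<noteq> \<infinity>"
    by (intro nn_integral_PInf_AE) auto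
  then have conv: "AE x in lborel. convergent (\<lambda>k. F (r k) x)"
  proof eventually_elim
    case (elim x)
    then have "summable (\<lambda>k. 4^k * (D k x)\<^sup>2)"
      by (intro summable_suminf_not_top) auto
    \<comment> \<open>Boundedness of the weighted terms already forces geometric decay of
      \<open>D k x\<close>: taking roots turns \<open>4^k\<close> into \<open>2^k\<close>.\<close>
    then have "Bseq (\<lambda>k. 4^k * (D k x)\<^sup>2)"
      by (intro convergent_imp_Bseq) (auto dest: summable_LIMSEQ_zero simp: convergent_def)
    then obtain C where C: "C > 0" "\<And>k. norm (4^k * (D k x)\<^sup>2) \<le> C"
      by (auto simp: Bseq_def)
    have D_le: "D k x \<le> sqrt C * (1/2)^k" for k
    proof -
      have "(2^k * D k x)\<^sup>2 \<le> C"
        using C(2)[of k] by (simp add: power_mult_distrib power_mult[symmetric] mult.commute[of k] power_mult)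
      then have "2^k * D k x \<le> sqrt C"
        by (rule real_le_rsqrt)
      then show ?thesis
        by (simp add: field_simps)
    qed
    have "summable (\<lambda>k. F (r (Suc k)) x - F (r k) x)"
    proof (rule summable_comparison_test'[where N = 0])
      show "summable (\<lambda>k. sqrt C * (1/2)^k)"
        by (intro summable_mult summable_geometric) simp
    qed (use D_le in \<open>auto simp: D_def\<close>)
    then have "convergent (\<lambda>n. \<Sum>k<n. F (r (Suc k)) x - F (r k) x)"
      by (simp add: summable_iff_convergent)
    then have "convergent (\<lambda>n. F (r n) x - F (r 0) x)"
      by (simp only: sum_lessThan_telescope[of "\<lambda>k. F (r k) x"])
    from convergent_add[OF this convergent_const[of "F (r 0) x"]] show ?case
      by simp
  qed
  \<comment> \<open>\<open>lim\<close> returns an unspecified value where the subsequence diverges,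
    which happens only on a null set.\<close>
  define g where "g x = lim (\<lambda>k. F (r k) x)" for x
  have g_meas [measurable]: "g \<in> borel_measurable borel"
    unfolding g_def by measurable
  have lim: "AE x in lborel. (\<lambda>k. F (r k) x) \<longlonglongrightarrow> g x"
    using conv by eventually_elim (simp add: g_def convergent_LIMSEQ_iff)
  \<comment> \<open>The bound holds for every index from \<open>M k\<close> on, not only along the
    subsequence, which serves merely to approximate \<open>g\<close> inside Fatou's lemma.\<close>
  have fatou: "L2_sq (\<lambda>x. F n x - g x) \<le> ennreal ((1/8)^k)" if "M k \<le> n" for n k
  proof -
    have "L2_sq (\<lambda>x. F n x - g x) = (\<integral>\<^sup>+x. liminf (\<lambda>j. ennreal ((cmod (F n x - F (r j) x))\<^sup>2)) \<partial>lborel)"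
      unfolding L2_sq_def
    proof (rule nn_integral_cong_AE, use lim in eventually_elim)
      case (elim x)
      then have "(\<lambda>j. ennreal ((cmod (F n x - F (r j) x))\<^sup>2)) \<longlonglongrightarrow> ennreal ((cmod (F n x - g x))\<^sup>2)"
        by (intro tendsto_intros tendsto_ennrealI)
      then show ?case
        by (intro lim_imp_Liminf[symmetric]) auto
    qed
    also have "\<dots> \<le> liminf (\<lambda>j. L2_sq (\<lambda>x. F n x - F (r j) x))"
      unfolding L2_sq_def by (rule nn_integral_liminf) measurable
    also have "\<dots> \<le> ennreal ((1/8)^k)"
    proof (rule Liminf_le)
      show "\<forall>\<^sub>F j in sequentially. L2_sq (\<lambda>x. F n x - F (r j) x) \<le> ennreal ((1/8)^k)"
        using eventually_ge_at_top[of "M k"]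
        by eventually_elim (use that r_ge in \<open>auto intro!: M intro: order_trans\<close>)
    qed simp
    finally show ?thesis .
  qed
  have "L2_sq g < \<infinity>"
  proof -
    have "L2_sq g = L2_sq (\<lambda>x. F (M 0) x + - (F (M 0) x - g x))"
      by simp
    also have "\<dots> \<le> 2 * L2_sq (F (M 0)) + 2 * L2_sq (\<lambda>x. - (F (M 0) x - g x))"
      by (rule L2_sq_add_le) measurable
    also have "L2_sq (\<lambda>x. - (F (M 0) x - g x)) = L2_sq (\<lambda>x. F (M 0) x - g x)"
      unfolding L2_sq_def norm_minus_cancel ..
    also have "2 * L2_sq (F (M 0)) + 2 * L2_sq (\<lambda>x. F (M 0) x - g x) < \<infinity>"
      using fin[of "M 0"] fatou[of 0 "M 0"]
      by (auto simp: ennreal_mult_less_top le_less_trans[OF fatou[of 0 "M 0"]])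
    finally show ?thesis .
  qed
  moreover have "(\<lambda>n. L2_sq (\<lambda>x. F n x - g x)) \<longlonglongrightarrow> 0"
  proof (rule order_tendstoI)
    fix e :: ennreal assume "0 < e"
    have "(\<lambda>k. ennreal ((1/8)^k)) \<longlonglongrightarrow> ennreal 0"
      by (intro tendsto_ennrealI LIMSEQ_power_zero) simp
    then have "\<forall>\<^sub>F k in sequentially. ennreal ((1/8)^k) < e"
      using order_tendstoD(2) \<open>0 < e\<close> by fastforce
    then obtain k where k: "ennreal ((1/8)^k) < e"
      by (auto simp: eventually_sequentially)
    show "\<forall>\<^sub>F n in sequentially. L2_sq (\<lambda>x. F n x - g x) < e"
      using eventually_ge_at_top[of "M k"]
      by eventually_elim (use fatou k in \<open>auto intro: le_less_trans\<close>)
  qed auto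
  ultimately show ?thesis
    using g_meas by blast
qed

section \<open>Truncations to balls and the transform they define\<close>

definition cutoff :: "nat \<Rightarrow> ('a::euclidean_space \<Rightarrow> complex) \<Rightarrow> 'a \<Rightarrow> complex" where
  "cutoff n f x = indicator (ball 0 (real n)) x * f x"

lemma cutoff_measurable [measurable]:
  "f \<in> borel_measurable borel \<Longrightarrow> cutoff n f \<in> borel_measurable borel"
  unfolding cutoff_def[abs_def] by (intro borel_measurable_times borel_measurable_indicator) auto

lemma L2_sq_cutoff_le: "L2_sq (cutoff n f) \<le> L2_sq f"
  unfolding L2_sq_def cutoff_def
  by (intro nn_integral_mono) (auto simp: indicator_def)

text \<open>The modulus of f is at most one plus its square, and balls have finite measure.\<close>

lemma integrable_cutoff:
  fixes f :: "'a::euclidean_space \<Rightarrow> complex"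
  assumes [measurable]: "f \<in> borel_measurable borel" and "L2_sq f < \<infinity>"
  shows "integrable lborel (cutoff n f)"
proof (rule integrableI_bounded)
  have "(\<integral>\<^sup>+x. ennreal (cmod (cutoff n f x)) \<partial>lborel) \<le>
      (\<integral>\<^sup>+x. indicator (ball 0 (real n)) x + ennreal ((cmod (f x))\<^sup>2) \<partial>lborel)"
  proof (intro nn_integral_mono)
    fix x :: 'a
    have "cmod (f x) \<le> 1 + (cmod (f x))\<^sup>2"
      using sum_squares_bound[of 1 "cmod (f x)"] norm_ge_zero[of "f x"] by (simp del: norm_ge_zero)
    then have "ennreal (cmod (f x)) \<le> ennreal (1 + (cmod (f x))\<^sup>2)"
      by (rule ennreal_leI)
    then show "ennreal (cmod (cutoff n f x)) \<le> indicator (ball 0 (real n)) x + ennreal ((cmod (f x))\<^sup>2)"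
      by (auto simp: cutoff_def indicator_def)
  qed
  also have "\<dots> = emeasure lborel (ball (0::'a) (real n)) + L2_sq f"
    unfolding L2_sq_def by (subst nn_integral_add) (auto intro!: borel_measurable_indicator)
  also have "\<dots> < \<infinity>"
    using assms(2) emeasure_bounded_finite[OF bounded_ball] by auto
  finally show "(\<integral>\<^sup>+x. ennreal (cmod (cutoff n f x)) \<partial>lborel) < \<infinity>" .
qed measurable

lemma cutoff_tendsto:
  fixes f :: "'a::euclidean_space \<Rightarrow> complex"
  assumes [measurable]: "f \<in> borel_measurable borel" and "L2_sq f < \<infinity>"
  shows "(\<lambda>n. L2_sq (\<lambda>x. cutoff n f x - f x)) \<longlonglongrightarrow> 0"
proof -
  have "(\<lambda>n. \<integral>\<^sup>+x. ennreal ((cmod (cutoff n f x - f x))\<^sup>2) \<partial>lborel) \<longlonglongrightarrow> (\<integral>\<^sup>+x. 0 \<partial>(lborel::'a measure))"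
  proof (rule nn_integral_dominated_convergence[where w = "\<lambda>x. ennreal ((cmod (f x))\<^sup>2)"])
    show "AE x in lborel. (\<lambda>n. ennreal ((cmod (cutoff n f x - f x))\<^sup>2)) \<longlonglongrightarrow> 0"
    proof (intro AE_I2 tendsto_eventually)
      fix x :: 'a
      show "\<forall>\<^sub>F n in sequentially. ennreal ((cmod (cutoff n f x - f x))\<^sup>2) = 0"
        using eventually_gt_at_top[of "nat \<lceil>norm x\<rceil>"]
        by eventually_elim (auto simp: cutoff_def indicator_def, linarith)
    qed
  qed (use assms in \<open>auto simp: L2_sq_def cutoff_def indicator_def\<close>)
  then show ?thesis
    by (simp add: L2_sq_def)
qed

lemma fourier_integral_diff:
  fixes u v :: "'a::euclidean_space \<Rightarrow> complex"
  assumes [measurable]: "u \<in> borel_measurable borel" "v \<in> borel_measurable borel"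
    and "integrable lborel u" "integrable lborel v"
  shows "fourier_integral u \<xi> - fourier_integral v \<xi> = fourier_integral (\<lambda>x. u x - v x) \<xi>"
proof -
  have "(LINT x|lborel. cis (- (x \<bullet> \<xi>)) * (u x - v x)) =
      (LINT x|lborel. cis (- (x \<bullet> \<xi>)) * u x) - (LINT x|lborel. cis (- (x \<bullet> \<xi>)) * v x)"
    unfolding right_diff_distrib using assms(3,4)[THEN integrable_fourier_kernel]
    by (rule Bochner_Integration.integral_diff)
  then show ?thesis
    by (simp add: fourier_integral_lborel right_diff_distrib)
qed

text \<open>Since \<open>fourier_L2\<close> is a choice, its properties need existence of the limit.
  \<open>bessel\<close> turns the Cauchy property of the truncations into that of their transforms,
  and \<open>riesz_fischer\<close> supplies the limit.\<close>

lemma fourier_L2_spec: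
  fixes f :: "'a::euclidean_space \<Rightarrow> complex"
  assumes [measurable]: "f \<in> borel_measurable borel" and fin: "L2_sq f < \<infinity>"
  shows "fourier_L2 f \<in> borel_measurable lebesgue"
    and "(\<lambda>n. L2_sq (\<lambda>\<xi>. fourier_integral (cutoff n f) \<xi> - fourier_L2 f \<xi>)) \<longlonglongrightarrow> 0"
proof -
  let ?F = "\<lambda>n. fourier_integral (cutoff n f)"
  have cut: "L2_sq (cutoff n f) < \<infinity>" for n
    using L2_sq_cutoff_le[of n f] fin by (rule le_less_trans)
  have diff: "L2_sq (\<lambda>\<xi>. ?F m \<xi> - ?F n \<xi>) \<le>
      2 * L2_sq (\<lambda>x. cutoff m f x - f x) + 2 * L2_sq (\<lambda>x. cutoff n f x - f x)" for m n
  proof -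
    let ?u = "\<lambda>x. cutoff m f x - cutoff n f x"
    have u: "L2_sq ?u \<le> 2 * L2_sq (\<lambda>x. cutoff m f x - f x) + 2 * L2_sq (\<lambda>x. cutoff n f x - f x)"
    proof -
      have "L2_sq ?u = L2_sq (\<lambda>x. (cutoff m f x - f x) + (f x - cutoff n f x))"
        by simp
      also have "\<dots> \<le> 2 * L2_sq (\<lambda>x. cutoff m f x - f x) + 2 * L2_sq (\<lambda>x. f x - cutoff n f x)"
        by (rule L2_sq_add_le) measurable
      also have "L2_sq (\<lambda>x. f x - cutoff n f x) = L2_sq (\<lambda>x. cutoff n f x - f x)"
        unfolding L2_sq_def by (simp add: norm_minus_commute)
      finally show ?thesis .
    qed
    \<comment> \<open>This second bound only supplies the finiteness that \<open>bessel\<close> asks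
      for.\<close>
    have "L2_sq ?u \<le> 2 * L2_sq (cutoff m f) + 2 * L2_sq (\<lambda>x. - cutoff n f x)"
      using L2_sq_add_le[of "cutoff m f" "\<lambda>x. - cutoff n f x"] by simp
    also have "L2_sq (\<lambda>x. - cutoff n f x) = L2_sq (cutoff n f)"
      by (simp add: L2_sq_def)
    also have "2 * L2_sq (cutoff m f) + 2 * L2_sq (cutoff n f) < \<infinity>"
      using cut[of m] cut[of n] by (simp add: ennreal_mult_less_top)
    finally have "L2_sq ?u < \<infinity>" .
    then have le: "L2_sq (fourier_integral ?u) \<le> L2_sq ?u"
      by (intro bessel) (auto intro!: integrable_cutoff fin)
    have eq: "fourier_integral ?u = (\<lambda>\<xi>. ?F m \<xi> - ?F n \<xi>)"
      using fin by (intro ext fourier_integral_diff[symmetric] integrable_cutoff) auto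
    from order_trans[OF le u] show ?thesis
      unfolding eq .
  qed
  have "\<exists>g \<in> borel_measurable borel. L2_sq g < \<infinity> \<and> (\<lambda>n. L2_sq (\<lambda>x. ?F n x - g x)) \<longlonglongrightarrow> 0"
  proof (rule riesz_fischer)
    show "L2_sq (?F n) < \<infinity>" for n
      using bessel[OF _ integrable_cutoff[OF assms] cut] cut[of n] by (auto intro: le_less_trans)
    show "\<exists>M. \<forall>m\<ge>M. \<forall>n\<ge>M. L2_sq (\<lambda>x. ?F m x - ?F n x) \<le> ennreal e" if "0 < e" for e :: real
    proof -
      have "\<forall>\<^sub>F n in sequentially. L2_sq (\<lambda>x. cutoff n f x - f x) < ennreal (e / 4)"
        using that by (intro order_tendstoD(2)[OF cutoff_tendsto[OF assms]]) auto
      then obtain M where M: "\<And>n. M \<le> n \<Longrightarrow> L2_sq (\<lambda>x. cutoff n f x - f x) \<le> ennreal (e / 4)"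
        by (auto simp: eventually_sequentially intro: less_imp_le)
      have "L2_sq (\<lambda>x. ?F m x - ?F n x) \<le> ennreal e" if "M \<le> m" "M \<le> n" for m n
      proof -
        have "L2_sq (\<lambda>x. ?F m x - ?F n x) \<le> 2 * ennreal (e / 4) + 2 * ennreal (e / 4)"
          using that by (intro order_trans[OF diff] add_mono mult_left_mono M) auto
        also have "\<dots> = ennreal 4 * ennreal (e / 4)"
          by (simp flip: distrib_right)
        also have "\<dots> = ennreal e"
          using \<open>0 < e\<close> by (subst ennreal_mult[symmetric]) auto
        finally show ?thesis .
      qed
      then show ?thesis
        by blast
    qed
  qed measurable
  then obtain g where g: "g \<in> borel_measurable borel" "L2_sq g < \<infinity>"
      "(\<lambda>n. L2_sq (\<lambda>x. ?F n x - g x)) \<longlonglongrightarrow> 0"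
    by blast
  have cut_eq: "(\<lambda>x. indicator (ball 0 (real n)) x * f x) = cutoff n f" for n
    by (simp add: cutoff_def fun_eq_iff)
  have spec_iff: "g \<in> L2 \<and>
      (\<lambda>n. L2_norm (\<lambda>\<xi>. fourier_integral (\<lambda>x. indicator (ball 0 (real n)) x * f x) \<xi> - g \<xi>)) \<longlonglongrightarrow> 0 \<longleftrightarrow>
      g \<in> borel_measurable lebesgue \<and> L2_sq g < \<infinity> \<and> (\<lambda>n. L2_sq (\<lambda>\<xi>. ?F n \<xi> - g \<xi>)) \<longlonglongrightarrow> 0" for g
    unfolding L2_def mem_Collect_eq L2_norm_less_top_iff L2_norm_tendsto_0_iff cut_eq by (simp only: conj_assoc)
  \<comment> \<open>The limit found is Borel, but the chosen representative is only known to be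
    Lebesgue measurable, so later measurability arguments about it use
    \<open>lebesgue\<close>.\<close>
  have "g \<in> borel_measurable lebesgue"
    using g(1) by (simp add: measurable_completion)
  with g(2,3) have "\<exists>g. g \<in> borel_measurable lebesgue \<and> L2_sq g < \<infinity> \<and> (\<lambda>n. L2_sq (\<lambda>\<xi>. ?F n \<xi> - g \<xi>)) \<longlonglongrightarrow> 0"
    by blast
  from someI_ex[OF this] show "fourier_L2 f \<in> borel_measurable lebesgue"
      "(\<lambda>n. L2_sq (\<lambda>\<xi>. ?F n \<xi> - fourier_L2 f \<xi>)) \<longlonglongrightarrow> 0"
    unfolding fourier_L2_def spec_iff by blast+
qed

section \<open>Energy bound at a single scale\<close>

lemma translation_diff_le:
  assumes [measurable]: "f \<in> borel_measurable borel"
  shows "translation_diff f h \<le> 4 * L2_sq f"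
proof -
  have "translation_diff f h = L2_sq (\<lambda>x. f (x + h) + - f x)"
    by (simp add: translation_diff_def L2_sq_def)
  also have "\<dots> \<le> 2 * L2_sq (\<lambda>x. f (x + h)) + 2 * L2_sq (\<lambda>x. - f x)"
    by (rule L2_sq_add_le) measurable
  also have "L2_sq (\<lambda>x. f (x + h)) = L2_sq f"
    unfolding L2_sq_def by (rule nn_integral_lborel_translate) measurable
  also have "L2_sq (\<lambda>x. - f x) = L2_sq f"
    by (simp add: L2_sq_def)
  also have "2 * L2_sq f + 2 * L2_sq f = 4 * L2_sq f"
    by (simp flip: distrib_right)
  finally show ?thesis .
qed

lemma heat_energy_le:
  fixes f :: "'a::euclidean_space \<Rightarrow> complex"
  assumes [measurable]: "f \<in> borel_measurable borel" and "0 < \<epsilon>"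
  shows "heat_energy \<epsilon> f \<le> 4 * L2_sq f"
proof -
  have "heat_energy \<epsilon> f \<le> (\<integral>\<^sup>+h. ennreal (heat_kernel \<epsilon> h) * (4 * L2_sq f) \<partial>(lborel :: 'a measure))"
    unfolding heat_energy_def
    by (intro nn_integral_mono mult_left_mono translation_diff_le) auto
  also have "\<dots> = 4 * L2_sq f"
    by (subst nn_integral_multc) (auto simp: nn_integral_heat_kernel[OF \<open>0 < \<epsilon>\<close>])
  finally show ?thesis .
qed

lemma heat_energy_add_le:
  fixes f g :: "'a::euclidean_space \<Rightarrow> complex"
  assumes [measurable]: "f \<in> borel_measurable borel" "g \<in> borel_measurable borel"
  shows "heat_energy \<epsilon> (\<lambda>x. f x + g x) \<le> 2 * heat_energy \<epsilon> f + 2 * heat_energy \<epsilon> g"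
proof -
  have "translation_diff (\<lambda>x. f x + g x) h \<le> 2 * translation_diff f h + 2 * translation_diff g h" for h
    using L2_sq_add_le[of "\<lambda>x. f (x + h) - f x" "\<lambda>x. g (x + h) - g x"]
    by (simp add: translation_diff_def L2_sq_def add_diff_add)
  then have "heat_energy \<epsilon> (\<lambda>x. f x + g x) \<le>
      (\<integral>\<^sup>+h. ennreal (heat_kernel \<epsilon> h) * (2 * translation_diff f h + 2 * translation_diff g h) \<partial>lborel)"
    unfolding heat_energy_def by (intro nn_integral_mono mult_left_mono) auto
  also have "\<dots> = (\<integral>\<^sup>+h. 2 * (ennreal (heat_kernel \<epsilon> h) * translation_diff f h)
      + 2 * (ennreal (heat_kernel \<epsilon> h) * translation_diff g h) \<partial>lborel)"
    by (simp add: distrib_left mult.left_commute)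
  also have "\<dots> = 2 * heat_energy \<epsilon> f + 2 * heat_energy \<epsilon> g"
    unfolding heat_energy_def by (subst nn_integral_add) (auto simp: nn_integral_cmult)
  finally show ?thesis .
qed

text \<open>From \<open>exp (- t) \<le> 1 / t\<close>. It trades the damping for the weight of the
  homogeneous norm.\<close>

lemma gauss_weight_le:
  assumes "0 < \<epsilon>" "\<xi> \<noteq> 0"
  shows "gauss_weight \<epsilon> \<xi> \<le> 2 / \<epsilon>\<^sup>2 / (norm \<xi>)\<^sup>2"
proof -
  define t where "t = (\<epsilon> * norm \<xi>)\<^sup>2 / 2"
  have "0 < t"
    using assms by (simp add: t_def)
  have "t \<le> exp t"
    using exp_ge_add_one_self[of t] by linarith
  then have "exp (- t) \<le> 1 / t"
    using \<open>0 < t\<close> by (simp add: exp_minus field_simps)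
  then show ?thesis
    by (simp add: gauss_weight_def t_def power_mult_distrib)
qed

text \<open>The damped Plancherel identity is available for integrable functions, so it is applied
  to truncations, followed by a passage to the limit. Each replacement of a truncated quantity by
  its limit costs a factor 2.\<close>

lemma L2_sq_le_heat_energy:
  fixes f :: "'a::euclidean_space \<Rightarrow> complex"
  assumes meas [measurable]: "f \<in> borel_measurable borel" and fin: "L2_sq f < \<infinity>" and "0 < \<epsilon>"
  shows "L2_sq f \<le> ennreal (8 / \<epsilon>\<^sup>2) * (Hdot_minus1_norm f)\<^sup>2 + 2 * heat_energy \<epsilon> f"
proof -
  define g where "g = fourier_L2 f"
  note spec = fourier_L2_spec[OF meas fin, folded g_def]
  have [measurable]: "g \<in> borel_measurable lebesgue"
    by (rule spec)
  define I where "I = (\<integral>\<^sup>+\<xi>. ennreal ((cmod (g \<xi>))\<^sup>2 * gauss_weight \<epsilon> \<xi>) \<partial>lebesgue)"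
  define a where "a n = L2_sq (\<lambda>x. cutoff n f x - f x)" for n
  define b where "b n = L2_sq (\<lambda>\<xi>. fourier_integral (cutoff n f) \<xi> - g \<xi>)" for n
  \<comment> \<open>The truncation errors \<open>a n\<close> in space and \<open>b n\<close> in
    frequency tend to 0, so the size of their coefficients is immaterial.\<close>
  have step: "L2_sq f \<le> (4 * I + 2 * heat_energy \<epsilon> f) + (4 * b n + 10 * a n)" for n
  proof -
    let ?u = "cutoff n f"
    have u: "L2_sq ?u < \<infinity>"
      using L2_sq_cutoff_le[of n f] fin by (rule le_less_trans)
    have "L2_sq f = L2_sq (\<lambda>x. ?u x + - (?u x - f x))"
      by simp
    also have "\<dots> \<le> 2 * L2_sq ?u + 2 * L2_sq (\<lambda>x. - (?u x - f x))"
      by (rule L2_sq_add_le) measurable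
    also have "L2_sq (\<lambda>x. - (?u x - f x)) = a n"
      unfolding L2_sq_def a_def norm_minus_cancel ..
    also have "2 * L2_sq ?u = 2 * (\<integral>\<^sup>+\<xi>. ennreal ((cmod (fourier_integral ?u \<xi>))\<^sup>2 * gauss_weight \<epsilon> \<xi>) \<partial>lborel) + heat_energy \<epsilon> ?u"
      using gaussian_plancherel[OF _ integrable_cutoff[OF meas fin] u \<open>0 < \<epsilon>\<close>] by simp
    finally have 1: "L2_sq f \<le> 2 * (\<integral>\<^sup>+\<xi>. ennreal ((cmod (fourier_integral ?u \<xi>))\<^sup>2 * gauss_weight \<epsilon> \<xi>) \<partial>lborel) + heat_energy \<epsilon> ?u + 2 * a n" .
    have "(\<integral>\<^sup>+\<xi>. ennreal ((cmod (fourier_integral ?u \<xi>))\<^sup>2 * gauss_weight \<epsilon> \<xi>) \<partial>lborel) =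
        (\<integral>\<^sup>+\<xi>. ennreal ((cmod (fourier_integral ?u \<xi>))\<^sup>2 * gauss_weight \<epsilon> \<xi>) \<partial>lebesgue)"
      by (simp add: nn_integral_completion)
    also have "\<dots> \<le> (\<integral>\<^sup>+\<xi>. 2 * ennreal ((cmod (g \<xi>))\<^sup>2 * gauss_weight \<epsilon> \<xi>) +
        2 * ennreal ((cmod (fourier_integral ?u \<xi> - g \<xi>))\<^sup>2) \<partial>lebesgue)"
    proof (rule nn_integral_mono)
      fix \<xi> :: 'a
      have w: "gauss_weight \<epsilon> \<xi> \<le> 1"
        by (simp add: gauss_weight_def)
      have "(cmod (fourier_integral ?u \<xi>))\<^sup>2 * gauss_weight \<epsilon> \<xi> \<le>
          (2 * (cmod (g \<xi>))\<^sup>2 + 2 * (cmod (fourier_integral ?u \<xi> - g \<xi>))\<^sup>2) * gauss_weight \<epsilon> \<xi>"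
        using cmod_add_power2_le[of "g \<xi>" "fourier_integral ?u \<xi> - g \<xi>"]
        by (intro mult_right_mono) auto
      also have "\<dots> \<le> 2 * ((cmod (g \<xi>))\<^sup>2 * gauss_weight \<epsilon> \<xi>) + 2 * (cmod (fourier_integral ?u \<xi> - g \<xi>))\<^sup>2"
        using mult_left_le[OF w, of "2 * (cmod (fourier_integral ?u \<xi> - g \<xi>))\<^sup>2"]
        by (simp add: distrib_right)
      finally have "ennreal ((cmod (fourier_integral ?u \<xi>))\<^sup>2 * gauss_weight \<epsilon> \<xi>) \<le>
          ennreal (2 * ((cmod (g \<xi>))\<^sup>2 * gauss_weight \<epsilon> \<xi>) + 2 * (cmod (fourier_integral ?u \<xi> - g \<xi>))\<^sup>2)"
        by (rule ennreal_leI)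
      also have "\<dots> = ennreal (2 * ((cmod (g \<xi>))\<^sup>2 * gauss_weight \<epsilon> \<xi>)) + ennreal (2 * (cmod (fourier_integral ?u \<xi> - g \<xi>))\<^sup>2)"
        by (rule ennreal_plus) auto
      also have "ennreal (2 * ((cmod (g \<xi>))\<^sup>2 * gauss_weight \<epsilon> \<xi>)) = 2 * ennreal ((cmod (g \<xi>))\<^sup>2 * gauss_weight \<epsilon> \<xi>)"
        by (subst ennreal_mult) auto
      also have "ennreal (2 * (cmod (fourier_integral ?u \<xi> - g \<xi>))\<^sup>2) = 2 * ennreal ((cmod (fourier_integral ?u \<xi> - g \<xi>))\<^sup>2)"
        by (subst ennreal_mult) auto
      finally show "ennreal ((cmod (fourier_integral ?u \<xi>))\<^sup>2 * gauss_weight \<epsilon> \<xi>) \<le>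
          2 * ennreal ((cmod (g \<xi>))\<^sup>2 * gauss_weight \<epsilon> \<xi>) + 2 * ennreal ((cmod (fourier_integral ?u \<xi> - g \<xi>))\<^sup>2)" .
    qed
    also have "\<dots> = 2 * I + 2 * b n"
    proof -
      have [measurable]: "fourier_integral ?u \<in> borel_measurable lebesgue"
        "gauss_weight \<epsilon> \<in> borel_measurable (lebesgue :: 'a measure)"
        by (auto intro!: measurable_completion)
      have "(\<integral>\<^sup>+\<xi>. ennreal ((cmod (fourier_integral ?u \<xi> - g \<xi>))\<^sup>2) \<partial>lebesgue) = b n"
        by (simp add: b_def L2_sq_def nn_integral_completion)
      then show ?thesis
        by (subst nn_integral_add) (auto simp: nn_integral_cmult I_def)
    qed
    finally have 2: "(\<integral>\<^sup>+\<xi>. ennreal ((cmod (fourier_integral ?u \<xi>))\<^sup>2 * gauss_weight \<epsilon> \<xi>) \<partial>lborel) \<le> 2 * I + 2 * b n" .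
    have "heat_energy \<epsilon> ?u = heat_energy \<epsilon> (\<lambda>x. f x + (?u x - f x))"
      by simp
    also have "\<dots> \<le> 2 * heat_energy \<epsilon> f + 2 * heat_energy \<epsilon> (\<lambda>x. ?u x - f x)"
      by (rule heat_energy_add_le) measurable
    also have "\<dots> \<le> 2 * heat_energy \<epsilon> f + 2 * (4 * a n)"
      unfolding a_def using \<open>0 < \<epsilon>\<close> by (intro add_left_mono mult_left_mono heat_energy_le) auto
    finally have 3: "heat_energy \<epsilon> ?u \<le> 2 * heat_energy \<epsilon> f + 2 * (4 * a n)" .
    have "L2_sq f \<le> 2 * (2 * I + 2 * b n) + (2 * heat_energy \<epsilon> f + 2 * (4 * a n)) + 2 * a n"
      using 2 3 by (intro order_trans[OF 1] add_mono mult_left_mono) auto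
    also have "\<dots> = (4 * I + 2 * heat_energy \<epsilon> f) + (4 * b n + (8 * a n + 2 * a n))"
      by (simp add: distrib_left ac_simps flip: mult.assoc)
    also have "8 * a n + 2 * a n = 10 * a n"
      by (simp flip: distrib_right)
    finally show ?thesis .
  qed
  have "(\<lambda>n. (4 * I + 2 * heat_energy \<epsilon> f) + (4 * b n + 10 * a n)) \<longlonglongrightarrow>
      (4 * I + 2 * heat_energy \<epsilon> f) + (4 * 0 + 10 * 0)"
    using spec(2) cutoff_tendsto[OF meas fin] unfolding a_def[symmetric] b_def[symmetric]
    by (intro tendsto_add tendsto_const ennreal_tendsto_cmult) auto
  then have "L2_sq f \<le> 4 * I + 2 * heat_energy \<epsilon> f"
    using step by (intro LIMSEQ_le_const[where a = "L2_sq f"]) auto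
  also have "4 * I \<le> ennreal (8 / \<epsilon>\<^sup>2) * (Hdot_minus1_norm f)\<^sup>2"
  proof -
    have "I \<le> (\<integral>\<^sup>+\<xi>. ennreal (2 / \<epsilon>\<^sup>2) * ennreal ((cmod (g \<xi>))\<^sup>2 / (norm \<xi>)\<^sup>2) \<partial>lebesgue)"
      unfolding I_def
    \<comment> \<open>At frequency 0 the quotient on the right is 0 by the convention for division,
      so the comparison can only be made almost everywhere.\<close>
    proof (rule nn_integral_mono_AE)
      have "AE \<xi> in lebesgue. \<xi> \<noteq> (0::'a)"
        by (simp add: AE_completion_iff AE_lborel_singleton)
      then show "AE \<xi> in lebesgue. ennreal ((cmod (g \<xi>))\<^sup>2 * gauss_weight \<epsilon> \<xi>) \<le>
          ennreal (2 / \<epsilon>\<^sup>2) * ennreal ((cmod (g \<xi>))\<^sup>2 / (norm \<xi>)\<^sup>2)"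
      proof eventually_elim
        case (elim \<xi>)
        have "ennreal ((cmod (g \<xi>))\<^sup>2 * gauss_weight \<epsilon> \<xi>) \<le> ennreal ((cmod (g \<xi>))\<^sup>2 * (2 / \<epsilon>\<^sup>2 / (norm \<xi>)\<^sup>2))"
          using elim \<open>0 < \<epsilon>\<close> by (intro ennreal_leI mult_left_mono gauss_weight_le) auto
        also have "(cmod (g \<xi>))\<^sup>2 * (2 / \<epsilon>\<^sup>2 / (norm \<xi>)\<^sup>2) = 2 / \<epsilon>\<^sup>2 * ((cmod (g \<xi>))\<^sup>2 / (norm \<xi>)\<^sup>2)"
          by simp
        finally show ?case
          by (simp only: ennreal_mult[of "2 / \<epsilon>\<^sup>2" "(cmod (g \<xi>))\<^sup>2 / (norm \<xi>)\<^sup>2"] zero_le_divide_iff zero_le_power2 zero_le_numeral simp_thms)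
      qed
    qed
    also have "\<dots> = ennreal (2 / \<epsilon>\<^sup>2) * (Hdot_minus1_norm f)\<^sup>2"
      unfolding Hdot_minus1_norm_def ennsqrt_power2 g_def[symmetric]
    proof (rule nn_integral_cmult)
      have [measurable]: "norm \<in> borel_measurable (lebesgue :: 'a measure)"
        by (intro measurable_completion) simp
      show "(\<lambda>\<xi>. ennreal ((cmod (g \<xi>))\<^sup>2 / (norm \<xi>)\<^sup>2)) \<in> borel_measurable lebesgue"
        by measurable
    qed
    finally have "4 * I \<le> ennreal 4 * (ennreal (2 / \<epsilon>\<^sup>2) * (Hdot_minus1_norm f)\<^sup>2)"
      by (simp add: mult_left_mono)
    also have "\<dots> = ennreal (8 / \<epsilon>\<^sup>2) * (Hdot_minus1_norm f)\<^sup>2"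
      by (subst mult.assoc[symmetric], subst ennreal_mult[symmetric]) auto
    finally show ?thesis .
  qed
  finally show ?thesis
    by (simp add: add_right_mono)
qed

section \<open>Summation over scales\<close>

text \<open>The bound depends neither on \<open>n\<close> nor on \<open>x\<close>: for a fixed
  \<open>h\<close>, only boundedly many of the unit-spaced scales contribute substantially.\<close>

lemma sum_exp_abs_le: "(\<Sum>j<n. exp (- \<bar>x + real j\<bar> / 2)) \<le> 6"
proof -
  \<comment> \<open>\<open>\<psi>\<close> takes values in \<open>[-1, 1]\<close> and its unit increments dominate the summands, so the sum telescopes.\<close>
  define \<psi> :: "real \<Rightarrow> real" where "\<psi> y = (if 0 \<le> y then 1 - exp (- y / 2) else exp (y / 2) - 1)" for y
  define c :: real where "c = exp (- 1 / 2)"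
  have "1 + 1 / 2 \<le> exp (1 / 2 :: real)"
    by (rule exp_ge_add_one_self)
  \<comment> \<open>So \<open>1 - c\<close> is at least 1/3, the origin of the factor 3 in
    \<open>incr\<close>.\<close>
  then have c: "0 < c" "c \<le> 2 / 3"
    by (auto simp: c_def exp_minus field_simps)
  have incr: "exp (- \<bar>y\<bar> / 2) \<le> 3 * (\<psi> (y + 1) - \<psi> y)" for y
  proof -
    consider "0 \<le> y" | "- 1 \<le> y" "y < 0" | "y < - 1"
      by linarith
    then have "(1 - c) * exp (- \<bar>y\<bar> / 2) \<le> \<psi> (y + 1) - \<psi> y"
    proof cases
      case 1
      have "exp (- (y + 1) / 2) = c * exp (- y / 2)"
        by (simp add: c_def mult_exp_exp add_divide_distrib diff_divide_distrib)
      with 1 show ?thesis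
        by (simp add: \<psi>_def algebra_simps)
    next
      \<comment> \<open>Here \<open>y\<close> and \<open>y + 1\<close> lie on different sides of the
        break at 0, so both branches of \<open>\<psi>\<close> enter.\<close>
      case 2
      define z where "z = exp (y / 2)"
      have z: "c \<le> z" "z \<le> 1" "0 < z"
        using 2 by (auto simp: z_def c_def)
      have "exp (- (y + 1) / 2) = c / z"
        by (simp add: c_def z_def exp_diff[symmetric] add_divide_distrib diff_divide_distrib)
      then have "\<psi> (y + 1) - \<psi> y = 2 - c / z - z"
        using 2 by (simp add: \<psi>_def z_def)
      moreover have "2 - c / z - z = (1 - c) + (1 - z) * (z - c) / z"
        using z by (simp add: field_simps)
      moreover have "0 \<le> (1 - z) * (z - c) / z"
        using z by simp
      moreover have "(1 - c) * exp (- \<bar>y\<bar> / 2) \<le> 1 - c"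
        using c by (intro mult_left_le) auto
      ultimately show ?thesis
        by linarith
    next
      case 3
      have "c * exp ((y + 1) / 2) = exp (y / 2)"
        by (simp add: c_def mult_exp_exp add_divide_distrib)
      moreover have "(1 - c) * exp (y / 2) \<le> (1 - c) * exp ((y + 1) / 2)"
        using c by (intro mult_left_mono) auto
      ultimately show ?thesis
        using 3 by (simp add: \<psi>_def algebra_simps)
    qed
    moreover have "1 / 3 * exp (- \<bar>y\<bar> / 2) \<le> (1 - c) * exp (- \<bar>y\<bar> / 2)"
      using c by (intro mult_right_mono) auto
    ultimately have "1 / 3 * exp (- \<bar>y\<bar> / 2) \<le> \<psi> (y + 1) - \<psi> y"
      by (rule order_trans[rotated])
    then show ?thesis
      by simp
  qed
  have "(\<Sum>j<n. exp (- \<bar>x + real j\<bar> / 2)) \<le> 3 * (\<psi> (x + real n) - \<psi> x)"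
  proof (induction n)
    case (Suc n)
    then show ?case
      using incr[of "x + real n"] by (simp add: add.assoc add.commute[of 1])
  qed simp
  also have "3 * (\<psi> (x + real n) - \<psi> x) \<le> 6"
  proof -
    have "\<psi> (x + real n) \<le> 1" "- 1 \<le> \<psi> x"
      by (auto simp: \<psi>_def intro!: order_trans[of "exp _" 1 2])
    then show ?thesis
      by simp
  qed
  finally show ?thesis .
qed

text \<open>As \<open>s\<close> is comparable to \<open>L\<close>, exchanging \<open>t\<close> for
  \<open>L\<close> in either direction costs at most a factor linear in
  \<open>1 + \<bar>s - t\<bar>\<close>. Up to a constant, any fixed power of this factor is
  dominated by \<open>exp (\<bar>s - t\<bar> / 2)\<close>.\<close>

lemma powr_ratio_le_exp:
  fixes \<gamma> B L s t :: real
  assumes "0 \<le> B" "0 < L" "1 \<le> s" "1 \<le> t" "L / 2 \<le> s" "s \<le> (1 + B) * L"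
  shows "exp (- \<bar>s - t\<bar> / 2) \<le> (4 * (1 + B) * (\<bar>\<gamma>\<bar> + 1)) powr (\<bar>\<gamma>\<bar> + 1) * (L powr \<gamma> / t powr \<gamma>)"
proof -
  define v where "v = \<bar>s - t\<bar>"
  define p where "p = \<bar>\<gamma>\<bar> + 1"
  define K where "K = 2 * (1 + B)"
  have v: "0 \<le> v" and p: "1 \<le> p" "\<bar>\<gamma>\<bar> \<le> p" and K: "2 \<le> K"
    using assms by (auto simp: v_def p_def K_def)
  have "t \<le> s + v" "s \<le> t + v"
    by (auto simp: v_def)
  moreover have "v \<le> v * s" "v \<le> v * t"
    using assms v by (simp_all add: mult_le_cancel_left1)
  ultimately have st: "t \<le> s * (1 + v)" "s \<le> t * (1 + v)"
    by (auto simp: distrib_left mult.commute)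
  have "t \<le> (1 + B) * L * (1 + v)"
    using v by (intro order_trans[OF st(1)] mult_right_mono assms(6)) auto
  also have "\<dots> \<le> K * (1 + v) * L"
    using assms v by (simp add: K_def mult_ac)
  finally have 1: "t / L \<le> K * (1 + v)"
    using assms by (simp add: field_simps)
  have "L \<le> 2 * (t * (1 + v))"
    using st(2) assms by simp
  also have "\<dots> \<le> K * (t * (1 + v))"
    using K assms v by (intro mult_right_mono) auto
  finally have 2: "L / t \<le> K * (1 + v)"
    using assms by (simp add: field_simps)
  have base: "1 \<le> K * (1 + v)"
    using K v by (intro order_trans[OF _ mult_mono[of 1 K 1 "1 + v"]]) auto
  have "t powr \<gamma> / L powr \<gamma> \<le> (K * (1 + v)) powr \<bar>\<gamma>\<bar>"
  proof (cases "0 \<le> \<gamma>")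
    case True
    then show ?thesis
      using 1 assms by (simp add: powr_divide[symmetric] powr_mono2)
  next
    case False
    have "t powr \<gamma> / L powr \<gamma> = (L / t) powr \<bar>\<gamma>\<bar>"
      using False assms by (simp add: powr_divide powr_minus field_simps)
    then show ?thesis
      using 2 assms by (simp add: powr_mono2)
  qed
  also have "\<dots> \<le> (K * (1 + v)) powr p"
    using base p by (intro powr_mono) auto
  \<comment> \<open>Dividing the argument by \<open>2 * p\<close> makes the power \<open>p\<close>
    of the exponential equal to \<open>exp (v / 2)\<close>. Taking \<open>p\<close> to be
    \<open>\<bar>\<gamma>\<bar> + 1\<close> ensures that it is positive.\<close>
  also have "\<dots> \<le> (K * (2 * p * exp (v / (2 * p)))) powr p"
  proof (intro powr_mono2 mult_left_mono)
    have "1 + v / (2 * p) \<le> exp (v / (2 * p))"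
      by (rule exp_ge_add_one_self)
    then have "2 * p * (1 + v / (2 * p)) \<le> 2 * p * exp (v / (2 * p))"
      using p by (intro mult_left_mono) auto
    then show "1 + v \<le> 2 * p * exp (v / (2 * p))"
      using p by (simp add: distrib_left)
  qed (use K p v in auto)
  also have "\<dots> = (2 * K * p) powr p * exp (v / 2)"
    using K p by (simp add: powr_mult exp_powr_real)
  finally have "t powr \<gamma> / L powr \<gamma> \<le> (2 * K * p) powr p * exp (v / 2)" .
  then have "exp (- (v / 2)) \<le> (2 * K * p) powr p * (L powr \<gamma> / t powr \<gamma>)"
    using assms by (simp add: exp_minus field_simps)
  then show ?thesis
    by (simp add: v_def p_def K_def)
qed

section \<open>Pointwise and tail bounds for the heat kernel\<close>

lemma power_le_fact_mult_exp: "0 \<le> t \<Longrightarrow> t ^ n \<le> fact n * exp (t :: real)"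
proof -
  assume "0 \<le> t"
  then have "(\<Sum>k\<in>{n}. t ^ k /\<^sub>R fact k) \<le> (\<Sum>k. t ^ k /\<^sub>R fact k)"
    by (intro sum_le_suminf summable_exp_generic) auto
  then show ?thesis
    by (simp add: exp_def field_simps)
qed

text \<open>With \<open>u = norm h / \<epsilon>\<close>, the kernel times
  \<open>norm h ^ DIM('a)\<close> is a constant multiple of
  \<open>u ^ d * exp (- u\<^sup>2 / 2)\<close>. This is at most a multiple of the smaller of
  \<open>u\<close> and \<open>1 / u\<close>, which equals
  \<open>exp (- \<bar>ln u\<bar>)\<close>.\<close>

lemma heat_kernel_le:
  fixes h :: "'a::euclidean_space"
  assumes "0 < \<epsilon>" "h \<noteq> 0"
  shows "heat_kernel \<epsilon> h \<le>
    2 ^ (DIM('a) + 1) * fact (DIM('a) + 1) * exp (- \<bar>ln (norm h / \<epsilon>)\<bar>) / norm h ^ DIM('a)"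
proof -
  define u where "u = norm h / \<epsilon>"
  define d where "d = DIM('a)"
  define C :: real where "C = 2 ^ (d + 1) * fact (d + 1)"
  have u: "0 < u" and d: "1 \<le> d"
    using assms by (auto simp: u_def d_def)
  have C: "1 \<le> C"
  proof -
    have "1 * 1 \<le> (2 :: real) ^ (d + 1) * fact (d + 1)"
      by (intro mult_mono one_le_power fact_ge_1) simp_all
    then show ?thesis
      by (simp only: C_def mult_1)
  qed
  have \<Phi>: "u ^ d * exp (- u\<^sup>2 / 2) \<le> C * exp (- \<bar>ln u\<bar>)"
  proof (cases "u \<le> 1")
    case True
    have "u ^ d * exp (- u\<^sup>2 / 2) \<le> u ^ 1 * 1"
      using u d True by (intro mult_mono power_decreasing) auto
    also have "\<dots> \<le> C * u"
      using C u by simp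
    also have "C * u = C * exp (- \<bar>ln u\<bar>)"
      using u True by simp
    finally show ?thesis .
  next
    case False
    \<comment> \<open>One power of \<open>u\<close> more than required is bounded; the surplus
      factor becomes the decay \<open>1 / u\<close>.\<close>
    have "u ^ (d + 1) \<le> u ^ (2 * (d + 1))"
      using False by (intro power_increasing) auto
    also have "\<dots> = 2 ^ (d + 1) * (u\<^sup>2 / 2) ^ (d + 1)"
      unfolding power_mult power_mult_distrib[symmetric] by simp
    also have "\<dots> \<le> 2 ^ (d + 1) * (fact (d + 1) * exp (u\<^sup>2 / 2))"
      by (intro mult_left_mono power_le_fact_mult_exp) auto
    finally have "u ^ d * u * exp (- (u\<^sup>2 / 2)) \<le> C"
      unfolding C_def by (simp add: exp_minus field_simps)
    then have "u ^ d * exp (- (u\<^sup>2 / 2)) \<le> C / u"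
      using u by (simp add: field_simps)
    also have "C / u = C * exp (- \<bar>ln u\<bar>)"
      using u False by (simp add: exp_minus field_simps)
    finally show ?thesis
      by simp
  qed
  have "heat_kernel \<epsilon> h * norm h ^ d = (1 / sqrt (2 * pi)) ^ d * (u ^ d * exp (- u\<^sup>2 / 2))"
    using assms by (simp add: heat_kernel_def u_def d_def power_divide power_mult_distrib)
  also have "\<dots> \<le> 1 * (C * exp (- \<bar>ln u\<bar>))"
  proof (rule mult_mono[OF _ \<Phi>])
    have "1 \<le> sqrt (2 * pi)"
      using pi_gt3 by (simp add: real_le_rsqrt)
    then show "(1 / sqrt (2 * pi)) ^ d \<le> 1"
      by (intro power_le_one) auto
  qed (use u in auto)
  finally show ?thesis
    using assms by (simp add: C_def u_def d_def field_simps)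
qed

text \<open>Half of the Gaussian exponent is estimated by its value at radius \<open>r\<close>. The
  other half is the kernel of width \<open>sqrt 2 * \<epsilon>\<close>, which has unit mass and a
  normalisation smaller by \<open>sqrt 2 ^ DIM('a)\<close>.\<close>

lemma heat_kernel_tail:
  assumes "0 < \<epsilon>" "0 \<le> r"
  shows "(\<integral>\<^sup>+h. ennreal (heat_kernel \<epsilon> h) * indicator (- ball 0 r) h \<partial>(lborel :: 'a::euclidean_space measure))
    \<le> ennreal (sqrt 2 ^ DIM('a) * exp (- (r / \<epsilon>)\<^sup>2 / 4))"
proof -
  define c where "c = sqrt 2 ^ DIM('a) * exp (- (r / \<epsilon>)\<^sup>2 / 4)"
  have "(\<integral>\<^sup>+h. ennreal (heat_kernel \<epsilon> h) * indicator (- ball 0 r) h \<partial>(lborel :: 'a measure)) \<le>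
      (\<integral>\<^sup>+h. ennreal c * ennreal (heat_kernel (sqrt 2 * \<epsilon>) h) \<partial>(lborel :: 'a measure))"
  proof (rule nn_integral_mono)
    fix h :: 'a
    have "heat_kernel \<epsilon> h \<le> c * heat_kernel (sqrt 2 * \<epsilon>) h" if "r \<le> norm h"
    proof -
      have "(norm h / \<epsilon>)\<^sup>2 / 4 \<ge> (r / \<epsilon>)\<^sup>2 / 4"
        using assms that by (intro divide_right_mono power_mono) auto
      then have "exp (- (norm h / \<epsilon>)\<^sup>2 / 2) \<le> exp (- (r / \<epsilon>)\<^sup>2 / 4 + - (norm h / (sqrt 2 * \<epsilon>))\<^sup>2 / 2)"
        by (simp add: power_divide power_mult_distrib)
      then have "(1 / (sqrt (2 * pi) * \<epsilon>)) ^ DIM('a) * exp (- (norm h / \<epsilon>)\<^sup>2 / 2) \<le>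
         (1 / (sqrt (2 * pi) * \<epsilon>)) ^ DIM('a) * (exp (- (r / \<epsilon>)\<^sup>2 / 4) * exp (- (norm h / (sqrt 2 * \<epsilon>))\<^sup>2 / 2))"
        using assms by (intro mult_left_mono) (auto simp: mult_exp_exp)
      also have "\<dots> = c * heat_kernel (sqrt 2 * \<epsilon>) h"
      proof -
        have "(1 / (sqrt (2 * pi) * \<epsilon>)) ^ DIM('a) = sqrt 2 ^ DIM('a) * (1 / (sqrt (2 * pi) * (sqrt 2 * \<epsilon>))) ^ DIM('a)"
          unfolding power_mult_distrib[symmetric] by simp
        then show ?thesis
          unfolding heat_kernel_def c_def by (simp only: mult_ac)
      qed
      finally show ?thesis
        unfolding heat_kernel_def .
    qed
    then show "ennreal (heat_kernel \<epsilon> h) * indicator (- ball 0 r) h \<le> ennreal c * ennreal (heat_kernel (sqrt 2 * \<epsilon>) h)"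
      using assms by (auto simp: indicator_def c_def ennreal_mult[symmetric] intro!: ennreal_leI)
  qed
  also have "\<dots> = ennreal c"
    using assms by (subst nn_integral_cmult) (auto simp: nn_integral_heat_kernel)
  finally show ?thesis
    unfolding c_def .
qed

text \<open>In logarithmic coordinates, with \<open>t = - ln (\<delta> * norm h)\<close>, the kernel
  at scale \<open>j\<close> decays like \<open>exp (- \<bar>s j - t\<bar>)\<close>. Half of this
  exponent pays for exchanging the power of \<open>t\<close> for that of \<open>L\<close>; the other
  half makes the sum bounded.\<close>

lemma sum_heat_kernel_le:
  fixes h :: "'a::euclidean_space" and \<gamma> B L \<delta> :: real
  assumes "0 \<le> B" "2 \<le> L" "0 < \<delta>" "h \<noteq> 0" "\<delta> * norm h < 1 / 5" "real n < L / 2 + 1"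
  shows "(\<Sum>j<n. heat_kernel (exp (- (L / 2 + B + real j)) / \<delta>) h) \<le>
    6 * (2 ^ (DIM('a) + 1) * fact (DIM('a) + 1)) * (4 * (1 + B) * (\<bar>\<gamma>\<bar> + 1)) powr (\<bar>\<gamma>\<bar> + 1) *
      L powr \<gamma> / (norm h ^ DIM('a) * \<bar>ln (\<delta> * norm h)\<bar> powr \<gamma>)"
proof -
  define t where "t = \<bar>ln (\<delta> * norm h)\<bar>"
  define C\<^sub>1 :: real where "C\<^sub>1 = 2 ^ (DIM('a) + 1) * fact (DIM('a) + 1)"
  define C\<^sub>2 where "C\<^sub>2 = (4 * (1 + B) * (\<bar>\<gamma>\<bar> + 1)) powr (\<bar>\<gamma>\<bar> + 1)"
  define s where "s j = L / 2 + B + real j" for j :: nat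
  have pos: "0 < \<delta> * norm h" "0 < norm h ^ DIM('a)"
    using assms by auto
  have C: "0 < C\<^sub>1" "0 \<le> C\<^sub>2"
    by (auto simp: C\<^sub>1_def C\<^sub>2_def)
  have t_eq: "t = - ln (\<delta> * norm h)"
    unfolding t_def using pos assms by (intro abs_of_nonpos) simp
  \<comment> \<open>The radius 1/5 and \<open>exp 1 \<le> 3\<close> keep \<open>t\<close> away from
    0, where its powers degenerate.\<close>
  have t: "1 \<le> t"
  proof -
    have "exp 1 * (\<delta> * norm h) \<le> 3 * (1 / 5)"
      using exp_le pos assms by (intro mult_mono) auto
    then have "exp 1 * (\<delta> * norm h) \<le> 1"
      by simp
    then have "ln (exp 1 * (\<delta> * norm h)) \<le> 0"
      using pos by simp
    then show ?thesis
      using pos unfolding t_eq by (subst (asm) ln_mult_pos) auto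
  qed
  have summand: "heat_kernel (exp (- s j) / \<delta>) h \<le>
      C\<^sub>1 / norm h ^ DIM('a) * (C\<^sub>2 * (L powr \<gamma> / t powr \<gamma>)) * exp (- \<bar>(L / 2 + B - t) + real j\<bar> / 2)" if "j < n" for j
  proof -
    \<comment> \<open>As \<open>j\<close> is at most \<open>n - 1\<close>, the extra 1 allowed in
      the bound on \<open>n\<close> is harmless.\<close>
    have j: "real j < L / 2"
      using that assms(6) by linarith
    have "B * 1 \<le> B * L"
      using assms by (intro mult_left_mono) auto
    then have s: "1 \<le> s j" "L / 2 \<le> s j" "s j \<le> (1 + B) * L"
      using assms j by (auto simp: s_def distrib_right)
    have "ln (norm h / (exp (- s j) / \<delta>)) = ln (exp (s j) * (\<delta> * norm h))"
      by (simp add: exp_minus field_simps)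
    also have "\<dots> = s j - t"
      using pos t_eq by (simp add: ln_mult_pos)
    finally have ln_eq: "ln (norm h / (exp (- s j) / \<delta>)) = s j - t" .
    have "exp (- \<bar>s j - t\<bar>) = exp (- \<bar>s j - t\<bar> / 2) * exp (- \<bar>s j - t\<bar> / 2)"
      by (simp add: mult_exp_exp)
    also have "\<dots> \<le> C\<^sub>2 * (L powr \<gamma> / t powr \<gamma>) * exp (- \<bar>s j - t\<bar> / 2)"
      unfolding C\<^sub>2_def using assms s t by (intro mult_right_mono powr_ratio_le_exp) auto
    finally have "exp (- \<bar>s j - t\<bar>) \<le> C\<^sub>2 * (L powr \<gamma> / t powr \<gamma>) * exp (- \<bar>s j - t\<bar> / 2)" .
    then have "C\<^sub>1 / norm h ^ DIM('a) * exp (- \<bar>s j - t\<bar>) \<le>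
        C\<^sub>1 / norm h ^ DIM('a) * (C\<^sub>2 * (L powr \<gamma> / t powr \<gamma>) * exp (- \<bar>s j - t\<bar> / 2))"
      using C pos by (intro mult_left_mono) auto
    moreover have "heat_kernel (exp (- s j) / \<delta>) h \<le> C\<^sub>1 * exp (- \<bar>s j - t\<bar>) / norm h ^ DIM('a)"
      unfolding ln_eq[symmetric] C\<^sub>1_def using assms by (intro heat_kernel_le) auto
    moreover have "s j - t = (L / 2 + B - t) + real j"
      by (simp add: s_def)
    ultimately show ?thesis
      by (simp add: mult.assoc)
  qed
  have "(\<Sum>j<n. heat_kernel (exp (- s j) / \<delta>) h) \<le>
      (\<Sum>j<n. C\<^sub>1 / norm h ^ DIM('a) * (C\<^sub>2 * (L powr \<gamma> / t powr \<gamma>)) * exp (- \<bar>(L / 2 + B - t) + real j\<bar> / 2))"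
    by (intro sum_mono summand) auto
  also have "\<dots> \<le> C\<^sub>1 / norm h ^ DIM('a) * (C\<^sub>2 * (L powr \<gamma> / t powr \<gamma>)) * 6"
    unfolding sum_distrib_left[symmetric] using C pos by (intro mult_left_mono sum_exp_abs_le) auto
  also have "\<dots> = 6 * C\<^sub>1 * C\<^sub>2 * L powr \<gamma> / (norm h ^ DIM('a) * t powr \<gamma>)"
    by (simp add: field_simps)
  finally show ?thesis
    unfolding s_def t_def C\<^sub>1_def C\<^sub>2_def .
qed

text \<open>Absorption: the low frequencies and the tail (\<open>2 * 4 / 32\<close>) each cost a
  quarter of the energy. The remaining half is at most twice the local integral.\<close>

lemma L2_sq_le_local_heat_energy:
  fixes f :: "'a::euclidean_space \<Rightarrow> complex"
  assumes meas [measurable]: "f \<in> borel_measurable borel" and fin: "L2_sq f < \<infinity>"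
    and "0 < \<epsilon>" "0 \<le> r"
    and low: "ennreal (8 / \<epsilon>\<^sup>2) * (Hdot_minus1_norm f)\<^sup>2 \<le> ennreal (1 / 4) * L2_sq f"
    and tail: "sqrt 2 ^ DIM('a) * exp (- (r / \<epsilon>)\<^sup>2 / 4) \<le> 1 / 32"
  shows "L2_sq f \<le> 4 * (\<integral>\<^sup>+h. ennreal (heat_kernel \<epsilon> h) * translation_diff f h * indicator (ball 0 r) h \<partial>lborel)"
    (is "_ \<le> 4 * ?X")
proof -
  have [measurable]: "ball (0 :: 'a) r \<in> sets borel" "- ball (0 :: 'a) r \<in> sets borel"
    by auto
  have "heat_energy \<epsilon> f = (\<integral>\<^sup>+h. ennreal (heat_kernel \<epsilon> h) * translation_diff f h * indicator (ball 0 r) h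
      + ennreal (heat_kernel \<epsilon> h) * translation_diff f h * indicator (- ball 0 r) h \<partial>lborel)"
    unfolding heat_energy_def by (intro nn_integral_cong) (auto simp: indicator_def)
  also have "\<dots> = ?X + (\<integral>\<^sup>+h. ennreal (heat_kernel \<epsilon> h) * translation_diff f h * indicator (- ball 0 r) h \<partial>lborel)"
    by (rule nn_integral_add) measurable
  also have "\<dots> \<le> ?X + (\<integral>\<^sup>+h. (ennreal (heat_kernel \<epsilon> h) * indicator (- ball 0 r) h) * (4 * L2_sq f) \<partial>(lborel :: 'a measure))"
    using translation_diff_le[OF meas]
    by (intro add_left_mono nn_integral_mono) (auto simp: indicator_def intro!: mult_left_mono)
  also have "\<dots> = ?X + (\<integral>\<^sup>+h. ennreal (heat_kernel \<epsilon> h) * indicator (- ball 0 r) h \<partial>(lborel :: 'a measure)) * (4 * L2_sq f)"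
    by (subst nn_integral_multc) measurable
  also have "\<dots> \<le> ?X + ennreal (1 / 32) * (4 * L2_sq f)"
    using order_trans[OF heat_kernel_tail[OF \<open>0 < \<epsilon>\<close> \<open>0 \<le> r\<close>] ennreal_leI[OF tail]]
    by (intro add_left_mono mult_right_mono) auto
  finally have HE: "heat_energy \<epsilon> f \<le> ?X + ennreal (1 / 32) * (4 * L2_sq f)" .
  obtain \<nu> where \<nu>: "0 \<le> \<nu>" "L2_sq f = ennreal \<nu>"
    using fin by (cases "L2_sq f") auto
  show ?thesis
  \<comment> \<open>Absorbing means subtracting, so the trivial infinite case is split off
    first.\<close>
  proof (cases "?X = \<infinity>")
    case True
    then show ?thesis
      by (simp add: ennreal_mult_top)
  next
    case False
    then obtain X where X: "0 \<le> X" "?X = ennreal X"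
      by (cases ?X) auto
    have "ennreal \<nu> \<le> ennreal (1 / 4) * ennreal \<nu> + 2 * (ennreal X + ennreal (1 / 32) * (4 * ennreal \<nu>))"
      using order_trans[OF L2_sq_le_heat_energy[OF meas fin \<open>0 < \<epsilon>\<close>] add_mono[OF low mult_left_mono[OF HE]]]
      unfolding \<nu> X by simp
    also have "\<dots> = ennreal (1 / 4 * \<nu> + 2 * (X + 1 / 32 * (4 * \<nu>)))"
    proof -
      have "ennreal (1 / 4) * ennreal \<nu> = ennreal (1 / 4 * \<nu>)"
        using \<nu>(1) by (intro ennreal_mult[symmetric]) auto
      moreover have "4 * ennreal \<nu> = ennreal (4 * \<nu>)"
        using \<nu>(1) by (subst ennreal_mult) auto
      moreover have "ennreal (1 / 32) * ennreal (4 * \<nu>) = ennreal (1 / 32 * (4 * \<nu>))"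
        using \<nu>(1) by (intro ennreal_mult[symmetric]) auto
      moreover have "2 * (ennreal X + ennreal (1 / 32 * (4 * \<nu>))) = ennreal (2 * (X + 1 / 32 * (4 * \<nu>)))"
        using \<nu>(1) X(1) by (subst ennreal_mult) auto
      ultimately show ?thesis
        using \<nu>(1) X(1) by (simp only:) (rule ennreal_plus[symmetric], auto)
    qed
    finally have "\<nu> \<le> 4 * X"
      using \<nu> X by (subst (asm) ennreal_le_iff) auto
    then have "ennreal \<nu> \<le> ennreal (4 * X)"
      by (rule ennreal_leI)
    also have "\<dots> = 4 * ennreal X"
      using X(1) by (subst ennreal_mult) auto
    finally show ?thesis
      unfolding \<nu> X .
  qed
qed

lemma exp_minus_le_inverse: "0 < x \<Longrightarrow> exp (- x) \<le> 1 / (x :: real)"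
proof -
  assume "0 < x"
  moreover have "x \<le> exp x"
    using exp_ge_add_one_self[of x] by linarith
  ultimately show ?thesis
    by (simp add: exp_minus field_simps)
qed

text \<open>
  The choice of \<open>B\<close> makes the mass that the heat kernels of width at most \<open>exp (- B) / \<delta>\<close> carry
  outside the ball of radius \<open>1 / (5 \<delta>)\<close> too small to matter.
\<close>

lemma high_frequency_bound:
  fixes f :: "'a::euclidean_space \<Rightarrow> complex" and \<gamma> B lam \<delta> :: real
  assumes meas [measurable]: "f \<in> borel_measurable borel" and fin: "L2_sq f < \<infinity>"
    and lam: "0 < lam" "lam < 1 / 100" and \<delta>: "0 < \<delta>" "\<delta> \<le> 1"
    and B: "B = ln (3200 * 2 ^ DIM('a))"
    and freq: "ennreal ((6 * exp B / lam)\<^sup>2) * (Hdot_minus1_norm f)\<^sup>2 \<le> L2_sq f"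
  defines "L \<equiv> \<bar>ln (\<delta> * lam)\<bar>"
    and "K \<equiv> 6 * (2 ^ (DIM('a) + 1) * fact (DIM('a) + 1)) * (4 * (1 + B) * (\<bar>\<gamma>\<bar> + 1)) powr (\<bar>\<gamma>\<bar> + 1)"
  shows "L2_sq f \<le> ennreal (8 * K) * (ennreal (1 / L powr (1 - \<gamma>)) *
    (\<integral>\<^sup>+h. ennreal (1 / (norm h ^ DIM('a) * \<bar>ln (\<delta> * norm h)\<bar> powr \<gamma>)) * translation_diff f h *
      indicator (ball 0 (1 / (5 * \<delta>))) h \<partial>lborel))"
    (is "_ \<le> _ * (_ * ?E)")
proof -
  define s where "s j = L / 2 + B + real j" for j :: nat
  define \<epsilon> where "\<epsilon> j = exp (- s j) / \<delta>" for j
  define r where "r = 1 / (5 * \<delta>)"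
  \<comment> \<open>Rounding up makes \<open>n\<close> at least \<open>L / 2\<close>, while every
    \<open>j < n\<close> still satisfies \<open>j < L / 2\<close>.\<close>
  define n where "n = nat \<lceil>L / 2\<rceil>"
  have [measurable]: "ball (0 :: 'a) r \<in> sets borel" "ball (0 :: 'a) (1 / (5 * \<delta>)) \<in> sets borel"
    by auto
  have exp_B: "exp B = 3200 * 2 ^ DIM('a)"
    unfolding B by simp
  have "1 * 1 \<le> (3200 :: real) * 2 ^ DIM('a)"
    by (intro mult_mono one_le_power) simp_all
  then have B0: "0 \<le> B"
    unfolding B by simp
  have \<delta>lam: "0 < \<delta> * lam" "\<delta> * lam \<le> 1 / 100"
    using lam \<delta> mult_mono[of \<delta> 1 lam "1 / 100"] by auto
  have L_eq: "L = - ln (\<delta> * lam)"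
    unfolding L_def using \<delta>lam by (intro abs_of_nonpos) simp
  have exp_L: "exp (- L) = \<delta> * lam"
    unfolding L_eq using \<delta>lam by simp
  \<comment> \<open>The smallness of \<open>lam\<close> enters here, through
    \<open>exp 2 \<le> 9\<close>.\<close>
  have L: "2 \<le> L"
  proof -
    have "exp 2 = exp 1 * exp (1 :: real)"
      by (simp add: mult_exp_exp)
    also have "\<dots> \<le> 3 * 3"
      using exp_le by (intro mult_mono) auto
    finally have "\<delta> * lam * exp 2 \<le> 1 / 100 * 9"
      using \<delta>lam by (intro mult_mono) auto
    then have "\<delta> * lam * exp 2 \<le> 1"
      by simp
    then have "ln (\<delta> * lam * exp 2) \<le> 0"
      using \<delta>lam by simp
    then show ?thesis
      unfolding L_eq using \<delta>lam by (subst (asm) ln_mult_pos) auto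
  qed
  have n: "L / 2 \<le> real n" "real n < L / 2 + 1"
    using L unfolding n_def by linarith+
  have K0: "0 < K"
    unfolding K_def using B0 by (auto simp: add_pos_nonneg)
  have eps: "0 < \<epsilon> j" for j
    using \<delta> by (simp add: \<epsilon>_def)
  have single: "L2_sq f \<le> 4 * (\<integral>\<^sup>+h. ennreal (heat_kernel (\<epsilon> j) h) * translation_diff f h * indicator (ball 0 r) h \<partial>lborel)"
    if "j < n" for j
  proof (rule L2_sq_le_local_heat_energy[OF meas fin])
    show "0 < \<epsilon> j" "0 \<le> r"
      using \<delta> by (auto simp: \<epsilon>_def r_def)
    have j: "real j < L / 2"
      using that n by linarith
    \<comment> \<open>As \<open>s j\<close> stays below \<open>L + B\<close>, no scale is shorter
      than \<open>exp (- B) * lam\<close>, so the single assumption \<open>freq\<close> serves all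
      of them.\<close>
    have "exp (- B) * lam = exp (- B - L) / \<delta>"
      using exp_L \<delta> by (simp add: exp_diff exp_minus field_simps)
    also have "\<dots> \<le> \<epsilon> j"
      unfolding \<epsilon>_def s_def using j \<delta> by (intro divide_right_mono) auto
    finally have "exp (- B) * lam \<le> \<epsilon> j" .
    then have "8 / (\<epsilon> j)\<^sup>2 \<le> 8 / (exp (- B) * lam)\<^sup>2"
      using lam eps[of j] by (intro divide_left_mono power_mono mult_pos_pos zero_less_power) auto
    also have "\<dots> = 8 * (exp B / lam)\<^sup>2"
      by (simp add: exp_minus field_simps)
    \<comment> \<open>The 6 in the threshold is chosen so that 8 is at most a quarter of its
      square.\<close>
    also have "\<dots> \<le> 1 / 4 * (6 * exp B / lam)\<^sup>2"
      by (simp add: power_mult_distrib power_divide divide_right_mono)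
    finally have "ennreal (8 / (\<epsilon> j)\<^sup>2) \<le> ennreal (1 / 4) * ennreal ((6 * exp B / lam)\<^sup>2)"
      by (subst ennreal_mult[symmetric]) (auto intro: ennreal_leI)
    then have "ennreal (8 / (\<epsilon> j)\<^sup>2) * (Hdot_minus1_norm f)\<^sup>2 \<le>
        ennreal (1 / 4) * (ennreal ((6 * exp B / lam)\<^sup>2) * (Hdot_minus1_norm f)\<^sup>2)"
      unfolding mult.assoc[symmetric] by (rule mult_right_mono) simp
    also have "\<dots> \<le> ennreal (1 / 4) * L2_sq f"
      by (rule mult_left_mono[OF freq]) simp
    finally show "ennreal (8 / (\<epsilon> j)\<^sup>2) * (Hdot_minus1_norm f)\<^sup>2 \<le> ennreal (1 / 4) * L2_sq f" .
    \<comment> \<open>The exponent of the tail is thus at least \<open>exp B / 100\<close>; dividing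
      the 3200 in \<open>B\<close> by 100 leaves the required 32.\<close>
    have "r / \<epsilon> j = exp (s j) / 5"
      using \<delta> by (simp add: r_def \<epsilon>_def exp_minus field_simps)
    then have "(r / \<epsilon> j)\<^sup>2 / 4 = exp (s j) * exp (s j) / 100"
      by (simp only:) (simp add: power2_eq_square)
    also have "\<dots> \<ge> 1 * exp B / 100"
      using B0 L by (intro divide_right_mono mult_mono) (auto simp: s_def)
    finally have x: "32 * 2 ^ DIM('a) \<le> (r / \<epsilon> j)\<^sup>2 / 4"
      by (simp add: exp_B)
    have "exp (- (r / \<epsilon> j)\<^sup>2 / 4) \<le> exp (- (32 * 2 ^ DIM('a)))"
      using x by simp
    also have "\<dots> \<le> 1 / (32 * 2 ^ DIM('a))"
      by (rule exp_minus_le_inverse) simp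
    finally have "sqrt 2 ^ DIM('a) * exp (- (r / \<epsilon> j)\<^sup>2 / 4) \<le> 2 ^ DIM('a) * (1 / (32 * 2 ^ DIM('a)))"
      by (intro mult_mono power_mono) (auto simp: real_le_lsqrt)
    then show "sqrt 2 ^ DIM('a) * exp (- (r / \<epsilon> j)\<^sup>2 / 4) \<le> 1 / 32"
      by simp
  qed
  let ?k = "\<lambda>h :: 'a. 1 / (norm h ^ DIM('a) * \<bar>ln (\<delta> * norm h)\<bar> powr \<gamma>)"
  \<comment> \<open>Adding the single-scale bounds gains a factor \<open>n\<close> of order
    \<open>L\<close>. Together with \<open>L powr \<gamma>\<close> from the sum of the kernels it
    produces the prefactor \<open>1 / L powr (1 - \<gamma>)\<close>.\<close>
  have "ennreal (real n) * L2_sq f = (\<Sum>j<n. L2_sq f)"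
    by (simp add: ennreal_of_nat_eq_real_of_nat)
  also have "\<dots> \<le> (\<Sum>j<n. 4 * (\<integral>\<^sup>+h. ennreal (heat_kernel (\<epsilon> j) h) * translation_diff f h * indicator (ball 0 r) h \<partial>lborel))"
    by (intro sum_mono single) auto
  also have "\<dots> = 4 * (\<integral>\<^sup>+h. (\<Sum>j<n. ennreal (heat_kernel (\<epsilon> j) h) * translation_diff f h * indicator (ball 0 r) h) \<partial>lborel)"
    unfolding sum_distrib_left[symmetric]
    by (subst nn_integral_sum) measurable
  also have "\<dots> \<le> 4 * (\<integral>\<^sup>+h. ennreal (K * L powr \<gamma>) * (ennreal (?k h) * translation_diff f h * indicator (ball 0 r) h) \<partial>lborel)"
  proof (intro mult_left_mono nn_integral_mono_AE)
    show "AE h in lborel. (\<Sum>j<n. ennreal (heat_kernel (\<epsilon> j) h) * translation_diff f h * indicator (ball 0 r) h)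
        \<le> ennreal (K * L powr \<gamma>) * (ennreal (?k h) * translation_diff f h * indicator (ball 0 r) h)"
      using AE_lborel_singleton[of "0 :: 'a"]
    proof eventually_elim
      case (elim h)
      show ?case
      proof (cases "h \<in> ball 0 r")
        case True
        then have "\<delta> * norm h < 1 / 5"
          using \<delta> by (simp add: r_def field_simps)
        then have "(\<Sum>j<n. heat_kernel (\<epsilon> j) h) \<le> K * L powr \<gamma> / (norm h ^ DIM('a) * \<bar>ln (\<delta> * norm h)\<bar> powr \<gamma>)"
          unfolding \<epsilon>_def s_def K_def using B0 L \<delta> elim n by (intro sum_heat_kernel_le) auto
        then have "ennreal (\<Sum>j<n. heat_kernel (\<epsilon> j) h) \<le> ennreal (K * L powr \<gamma> * ?k h)"
          by (intro ennreal_leI) simp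
        also have "\<dots> = ennreal (K * L powr \<gamma>) * ennreal (?k h)"
          using K0 by (intro ennreal_mult) auto
        finally have "(\<Sum>j<n. ennreal (heat_kernel (\<epsilon> j) h)) * translation_diff f h \<le>
            ennreal (K * L powr \<gamma>) * ennreal (?k h) * translation_diff f h"
          using eps by (intro mult_right_mono) (auto simp: sum_ennreal)
        then show ?thesis
          using True by (simp add: sum_distrib_right mult.assoc)
      qed simp
    qed
  qed simp
  also have "\<dots> = 4 * (ennreal (K * L powr \<gamma>) * ?E)"
    unfolding r_def by (subst nn_integral_cmult) measurable
  finally have sum: "ennreal (real n) * L2_sq f \<le> 4 * (ennreal (K * L powr \<gamma>) * ?E)" .
  have n0: "0 < real n"
    using n L by linarith
  have "L2_sq f = ennreal (1 / real n) * (ennreal (real n) * L2_sq f)"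
    using n0 by (simp add: mult.assoc[symmetric] ennreal_mult[symmetric])
  also have "\<dots> \<le> ennreal (1 / real n) * (ennreal 4 * (ennreal (K * L powr \<gamma>) * ?E))"
    using sum by (intro mult_left_mono) auto
  also have "\<dots> = ennreal (1 / real n * (4 * (K * L powr \<gamma>))) * ?E"
  proof -
    have "ennreal (1 / real n * (4 * (K * L powr \<gamma>))) = ennreal (1 / real n) * ennreal (4 * (K * L powr \<gamma>))"
      using K0 by (intro ennreal_mult) auto
    also have "ennreal (4 * (K * L powr \<gamma>)) = ennreal 4 * ennreal (K * L powr \<gamma>)"
      using K0 by (intro ennreal_mult) auto
    finally show ?thesis
      by (simp only: mult.assoc)
  qed
  also have "\<dots> \<le> ennreal (8 * K * (1 / L powr (1 - \<gamma>))) * ?E"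
  proof (intro mult_right_mono ennreal_leI)
    have "1 / real n \<le> 2 / L"
      using n L by (simp add: field_simps)
    then have "1 / real n * (4 * (K * L powr \<gamma>)) \<le> 2 / L * (4 * (K * L powr \<gamma>))"
      using K0 by (intro mult_right_mono) auto
    also have "\<dots> = 8 * K * (1 / L powr (1 - \<gamma>))"
      using L by (simp add: powr_diff)
    finally show "1 / real n * (4 * (K * L powr \<gamma>)) \<le> 8 * K * (1 / L powr (1 - \<gamma>))" .
  qed simp
  also have "\<dots> = ennreal (8 * K) * (ennreal (1 / L powr (1 - \<gamma>)) * ?E)"
    using K0 by (subst ennreal_mult) (auto simp: mult.assoc)
  finally show ?thesis .
qed

section \<open>The inequality\<close>

text \<open>It supplies the Borel representative to which the energy estimates apply; real and
  imaginary parts are treated separately.\<close>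

lemma ex_borel_AE_eq:
  fixes f :: "'a::euclidean_space \<Rightarrow> complex"
  assumes [measurable]: "f \<in> borel_measurable lebesgue"
  obtains g where "g \<in> borel_measurable borel" "AE x in lborel. f x = g x"
proof -
  have "(\<lambda>x. Re (f x)) \<in> borel_measurable lebesgue" "(\<lambda>x. Im (f x)) \<in> borel_measurable lebesgue"
    by measurable
  from this[THEN completion_ex_borel_measurable_real] obtain a b
    where [measurable]: "a \<in> borel_measurable lborel" "b \<in> borel_measurable lborel"
      and ae: "AE x in lborel. Re (f x) = a x" "AE x in lborel. Im (f x) = b x"
    by blast
  show thesis
  proof
    show "(\<lambda>x. of_real (a x) + \<i> * of_real (b x)) \<in> borel_measurable borel"
      by measurable
    show "AE x in lborel. f x = of_real (a x) + \<i> * of_real (b x)"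
      using ae by eventually_elim (simp add: complex_eq_iff)
  qed
qed

lemma AE_lborel_translate:
  fixes h :: "'a::euclidean_space"
  assumes "AE x in lborel. P x"
  shows "AE x in lborel. P (x + h)"
proof -
  have "AE x in distr lborel borel ((+) h). P x"
    using assms by (simp only: lborel_distr_plus)
  then have "AE x in lborel. P (h + x)"
    by (rule AE_distrD[rotated]) measurable
  then show ?thesis
    by (simp only: add.commute)
qed

text \<open>The truncated Fourier integrals agree at every frequency, not just almost everywhere.
  Hence the choice operator acts on identical predicates, and the transforms are equal as
  functions.\<close>

lemma fourier_L2_cong_AE:
  fixes f g :: "'a::euclidean_space \<Rightarrow> complex"
  assumes [measurable]: "f \<in> borel_measurable lebesgue" "g \<in> borel_measurable lebesgue"
    and ae: "AE x in lborel. f x = g x"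
  shows "fourier_L2 f = fourier_L2 g"
proof -
  have "fourier_integral (\<lambda>x. indicator (ball 0 (real n)) x * f x) = fourier_integral (\<lambda>x. indicator (ball 0 (real n)) x * g x)" for n
  proof -
    have [measurable]: "(\<lambda>x::'a. cis (- (x \<bullet> \<xi>))) \<in> borel_measurable lebesgue"
        "(indicator (ball 0 (real n)) :: 'a \<Rightarrow> complex) \<in> borel_measurable lebesgue" for \<xi>
      by (auto intro!: measurable_completion borel_measurable_indicator simp: cis_conv_exp)
    have "AE x in lebesgue. f x = g x"
      using ae by (rule AE_completion)
    then have "(LINT x|lebesgue. cis (- (x \<bullet> \<xi>)) * (indicator (ball 0 (real n)) x * f x)) =
        (LINT x|lebesgue. cis (- (x \<bullet> \<xi>)) * (indicator (ball 0 (real n)) x * g x))" for \<xi>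
      by (intro integral_cong_AE) auto
    then show ?thesis
      unfolding fourier_integral_def by simp
  qed
  then show ?thesis
    unfolding fourier_L2_def by simp
qed

text \<open>Below the threshold, \<open>ln (2 + X)\<close> exceeds \<open>\<bar>ln lam\<bar>\<close>
  by at most an additive constant, which is absorbed because \<open>\<bar>ln lam\<bar>\<close> is
  bounded below.\<close>

lemma low_frequency_bound:
  fixes B lam X :: real and N :: ennreal
  assumes "0 \<le> B" "0 < lam" "lam < 1 / 100" "0 \<le> X" "X \<le> 6 * exp B / lam" "N < \<infinity>"
  shows "N \<le> ennreal (15 + 2 * B) * (ennreal \<bar>ln lam\<bar> * (N / ennreal (ln (2 + X))))"
proof -
  obtain \<nu> where \<nu>: "0 \<le> \<nu>" "N = ennreal \<nu>"
    using \<open>N < \<infinity>\<close> by (cases N) auto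
  have l: "0 < ln (2 + X)"
    using assms by simp
  have quot: "0 \<le> \<nu> / ln (2 + X)"
    using \<nu>(1) l by (intro divide_nonneg_pos)
  have ln_lam: "ln lam \<le> - 1 / 2"
    using ln_le_minus_one[of lam] assms by linarith
  have "2 + X \<le> 8 * (exp B / lam)"
  proof -
    define q where "q = exp B / lam"
    have "1 \<le> exp B"
      using assms by simp
    then have "lam \<le> exp B"
      using assms by linarith
    then have "1 \<le> q"
      using assms unfolding q_def by (subst le_divide_eq_1_pos) auto
    moreover have "X \<le> 6 * q"
      using assms by (simp add: q_def)
    ultimately have "2 + X \<le> 8 * q"
      by linarith
    then show ?thesis
      unfolding q_def .
  qed
  then have "ln (2 + X) \<le> ln (8 * (exp B / lam))"
    using assms by (subst ln_le_cancel_iff) auto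
  also have "\<dots> = ln 8 + (B - ln lam)"
    using assms by (simp add: ln_mult_pos ln_div)
  also have "\<dots> \<le> 7 + (B - ln lam)"
    using ln_le_minus_one[of "8 :: real"] by simp
  \<comment> \<open>Since \<open>\<bar>ln lam\<bar> \<ge> 1 / 2\<close>, the constant
    \<open>7 + B\<close> is at most \<open>(14 + 2 * B) * \<bar>ln lam\<bar>\<close>; the remaining
    \<open>- ln lam\<close> raises 14 to 15.\<close>
  also have "\<dots> \<le> (15 + 2 * B) * \<bar>ln lam\<bar>"
  proof -
    have "(14 + 2 * B) * (1 / 2) \<le> (14 + 2 * B) * \<bar>ln lam\<bar>"
      using assms ln_lam by (intro mult_left_mono) auto
    moreover have "\<bar>ln lam\<bar> = - ln lam"
      using ln_lam by simp
    ultimately show ?thesis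
      by (simp add: algebra_simps)
  qed
  finally have "\<nu> * ln (2 + X) \<le> \<nu> * ((15 + 2 * B) * \<bar>ln lam\<bar>)"
    using \<nu>(1) by (rule mult_left_mono)
  then have "\<nu> \<le> (15 + 2 * B) * (\<bar>ln lam\<bar> * (\<nu> / ln (2 + X)))"
    using l by (simp add: field_simps)
  then have "ennreal \<nu> \<le> ennreal ((15 + 2 * B) * (\<bar>ln lam\<bar> * (\<nu> / ln (2 + X))))"
    by (rule ennreal_leI)
  also have "\<dots> = ennreal (15 + 2 * B) * ennreal (\<bar>ln lam\<bar> * (\<nu> / ln (2 + X)))"
    using assms quot by (intro ennreal_mult mult_nonneg_nonneg abs_ge_zero) auto
  also have "ennreal (\<bar>ln lam\<bar> * (\<nu> / ln (2 + X))) = ennreal \<bar>ln lam\<bar> * ennreal (\<nu> / ln (2 + X))"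
    using quot by (intro ennreal_mult abs_ge_zero)
  also have "ennreal (\<nu> / ln (2 + X)) = N / ennreal (ln (2 + X))"
    unfolding \<nu>(2) using \<nu>(1) l by (intro divide_ennreal[symmetric]) auto
  finally show ?thesis
    unfolding \<nu>(2) .
qed

text \<open>This passes from the real-valued ratio of norms, with its default values, to the
  division-free condition on squares needed at high frequencies.\<close>

lemma ennreal_mult_power2_le_of_le_divide:
  fixes a b :: ennreal and x :: real
  assumes "0 < x" "x \<le> enn2real (a / b)" "a < \<infinity>"
  shows "ennreal (x\<^sup>2) * b\<^sup>2 \<le> a\<^sup>2"
proof -
  have "a / b \<noteq> 0" "a / b \<noteq> \<infinity>"
    using assms by auto
  \<comment> \<open>For \<open>b = 0\<close> the quotient is \<open>0\<close> or \<open>\<infinity>\<close>, and \<open>enn2real\<close> maps both to \<open>0\<close>.\<close>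
  then have "b \<noteq> \<infinity>" "b \<noteq> 0"
    using assms by (auto simp: ennreal_divide_top divide_ennreal_def ennreal_mult_eq_top_iff)
  then obtain l h where lh: "0 \<le> l" "a = ennreal l" "0 < h" "b = ennreal h"
    using \<open>a < \<infinity>\<close> by (cases a; cases b) (auto simp: less_le)
  then have "x \<le> l / h"
    using assms(2) by (simp add: divide_ennreal)
  then have "(x * h)\<^sup>2 \<le> l\<^sup>2"
    using lh assms(1) by (intro power_mono) (auto simp: field_simps)
  then have "ennreal ((x * h)\<^sup>2) \<le> ennreal (l\<^sup>2)"
    by (rule ennreal_leI)
  then show ?thesis
    using lh assms(1) by (simp add: power_mult_distrib ennreal_mult ennreal_power)
qed

theorem proposition3p5:
  fixes \<gamma> :: real
  assumes "\<gamma> < 1"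
  shows "\<exists>C::real. C > 0 \<and>
    (\<forall>lam::real. \<forall>\<delta>::real. \<forall>f :: 'a::euclidean_space \<Rightarrow> complex.
      0 < lam \<and> lam < 1 / 100 \<and> 0 < \<delta> \<and> \<delta> \<le> 1 \<and> f \<in> L2 \<longrightarrow>
      (L2_norm f)\<^sup>2 \<le> ennreal C *
        (ennreal (1 / \<bar>ln (\<delta> * lam)\<bar> powr (1 - \<gamma>)) *
           (\<integral>\<^sup>+h\<in>ball 0 (1 / (5 * \<delta>)).
              (\<integral>\<^sup>+x. ennreal ((cmod (f (x + h) - f x))\<^sup>2 /
                 (norm h ^ DIM('a) * \<bar>ln (\<delta> * norm h)\<bar> powr \<gamma>)) \<partial>lebesgue) \<partial>lebesgue)
         + ennreal \<bar>ln lam\<bar> *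
             ((L2_norm f)\<^sup>2 / ennreal (ln (2 + enn2real (L2_norm f / Hdot_minus1_norm f))))))"
proof -
  \<comment> \<open>\<open>B\<close> depends on the dimension only and \<open>K\<close> on the
    dimension and \<gamma>, so \<open>C\<close> is fixed before \<open>lam\<close>, \<delta> and
    \<open>f\<close>.\<close>
  define B :: real where "B = ln (3200 * 2 ^ DIM('a))"
  define K where "K = 6 * (2 ^ (DIM('a) + 1) * fact (DIM('a) + 1)) * (4 * (1 + B) * (\<bar>\<gamma>\<bar> + 1)) powr (\<bar>\<gamma>\<bar> + 1)"
  define C where "C = 8 * K + (15 + 2 * B)"
  have "1 * 1 \<le> (3200 :: real) * 2 ^ DIM('a)"
    by (intro mult_mono one_le_power) simp_all
  then have B0: "0 \<le> B"
    unfolding B_def by simp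
  have K0: "0 \<le> K"
    unfolding K_def by simp
  show ?thesis
  proof (intro exI[of _ C] conjI allI impI)
    show "0 < C"
      using B0 K0 by (simp add: C_def)
  next
    fix lam \<delta> :: real and f :: "'a \<Rightarrow> complex"
    assume asm: "0 < lam \<and> lam < 1 / 100 \<and> 0 < \<delta> \<and> \<delta> \<le> 1 \<and> f \<in> L2"
    then have f [measurable]: "f \<in> borel_measurable lebesgue" and fin: "L2_norm f < \<infinity>"
      by (auto simp: L2_def)
    let ?N = "(L2_norm f)\<^sup>2"
    let ?X = "enn2real (L2_norm f / Hdot_minus1_norm f)"
    let ?k = "\<lambda>h :: 'a. 1 / (norm h ^ DIM('a) * \<bar>ln (\<delta> * norm h)\<bar> powr \<gamma>)"
    let ?low = "ennreal \<bar>ln lam\<bar> * (?N / ennreal (ln (2 + ?X)))"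
    let ?high = "ennreal (1 / \<bar>ln (\<delta> * lam)\<bar> powr (1 - \<gamma>)) *
      (\<integral>\<^sup>+h\<in>ball 0 (1 / (5 * \<delta>)). (\<integral>\<^sup>+x. ennreal ((cmod (f (x + h) - f x))\<^sup>2 /
        (norm h ^ DIM('a) * \<bar>ln (\<delta> * norm h)\<bar> powr \<gamma>)) \<partial>lebesgue) \<partial>lebesgue)"
    obtain g where g [measurable]: "g \<in> borel_measurable borel" and ae: "AE x in lborel. f x = g x"
      by (rule ex_borel_AE_eq[OF f])
    have N: "?N = L2_sq g"
      unfolding L2_norm_power2 L2_sq_def using ae by (intro nn_integral_cong_AE) auto
    have N_fin: "L2_sq g < \<infinity>"
      unfolding N[symmetric] using fin by (simp add: power2_eq_square ennreal_mult_less_top)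
    have "fourier_L2 f = fourier_L2 g"
      using ae by (intro fourier_L2_cong_AE) (auto intro: measurable_completion)
    then have H: "Hdot_minus1_norm f = Hdot_minus1_norm g"
      unfolding Hdot_minus1_norm_def by simp
    have inner: "(\<integral>\<^sup>+x. ennreal ((cmod (f (x + h) - f x))\<^sup>2 /
        (norm h ^ DIM('a) * \<bar>ln (\<delta> * norm h)\<bar> powr \<gamma>)) \<partial>lebesgue) = ennreal (?k h) * translation_diff g h" for h
    proof -
      have "(\<integral>\<^sup>+x. ennreal ((cmod (f (x + h) - f x))\<^sup>2 /
          (norm h ^ DIM('a) * \<bar>ln (\<delta> * norm h)\<bar> powr \<gamma>)) \<partial>lebesgue) =
          (\<integral>\<^sup>+x. ennreal (?k h) * ennreal ((cmod (g (x + h) - g x))\<^sup>2) \<partial>lborel)"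
        unfolding nn_integral_completion
        using ae AE_lborel_translate[OF ae, of h]
        by (intro nn_integral_cong_AE, eventually_elim) (simp add: ennreal_mult[symmetric])
      also have "\<dots> = ennreal (?k h) * translation_diff g h"
        unfolding translation_diff_def by (rule nn_integral_cmult) measurable
      finally show ?thesis .
    qed
    show "?N \<le> ennreal C * (?high + ?low)"
    \<comment> \<open>\<open>?X\<close> is 0 when the quotient of the norms is 0 and also when it is
      infinite, so these degenerate cases fall under the second alternative.\<close>
    proof (cases "6 * exp B / lam \<le> ?X")
      case True
      have "ennreal ((6 * exp B / lam)\<^sup>2) * (Hdot_minus1_norm g)\<^sup>2 \<le> L2_sq g"
        unfolding N[symmetric] H[symmetric]
        using True fin asm by (intro ennreal_mult_power2_le_of_le_divide) auto
      then have "L2_sq g \<le> ennreal (8 * K) * (ennreal (1 / \<bar>ln (\<delta> * lam)\<bar> powr (1 - \<gamma>)) *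
          (\<integral>\<^sup>+h. ennreal (?k h) * translation_diff g h * indicator (ball 0 (1 / (5 * \<delta>))) h \<partial>lborel))"
        unfolding K_def using asm by (intro high_frequency_bound g N_fin B_def) auto
      also have "\<dots> = ennreal (8 * K) * ?high"
        unfolding nn_integral_completion[of lborel "\<lambda>h. _ h * indicator _ h"] inner ..
      also have "\<dots> \<le> ennreal C * (?high + ?low)"
        using B0 by (intro mult_mono) (auto simp: C_def intro: ennreal_leI)
      finally show ?thesis
        unfolding N .
    next
      case False
      then have "?N \<le> ennreal (15 + 2 * B) * ?low"
        using B0 asm N_fin unfolding N[symmetric] by (intro low_frequency_bound) auto
      also have "\<dots> \<le> ennreal C * (?high + ?low)"
        using K0 by (intro mult_mono) (auto simp: C_def intro: ennreal_leI)
      finally show ?thesis .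
    qed
  qed
qed

end
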